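(* For $z\in\mathbb{C}\setminus\mathbb{N}$, we have $$\mathcal{H}(z)=\left\langle(I-zT)^{-1}u,u\right\rangle.$$ The nonzero spectrum of $T_\perp$ is $$\sigma(T_\perp)\setminus\{0\}=\left\{\frac1{\rho_n}:n\ge1\right\},$$ and every nonzero eigenvalue of $T_\perp$ is simple.
   Context: $\mathbb{N}=\{1,2,\ldots\}$. The Gregory coefficients $(G_n)_{n\ge0}$ are defined by $\frac{z}{\log(1+z)}=\sum_{n=0}^{\infty}G_nz^n$ for $|z|<1$; they satisfy $\sum_{n\ge1}|G_n|=1$. The Gregory function is the entire function $\mathcal{G}(z)=\frac{1}{\Gamma(z+1)}\int_0^1\frac{\Gamma(x+1)}{\Gamma(x-z+1)}\,dx$ (with $1/\Gamma$ entire), and the completed Gregory transform is $\mathcal{H}(z)=\frac{\pi z}{\sin\pi z}\mathcal{G}(z)$, regarded as a holomorphic function on $\mathbb{C}\setminus\mathbb{N}$ (the singularities at nonpositive integers are removable). For each $n\ge1$, $\rho_n$ denotes the unique zero of $\mathcal{H}$ (equivalently of $\mathcal{G}$) in the interval $(n,n+1)$. On the Hilbert space $\ell^2(\mathbb{N})$ with standard orthonormal basis $(e_n)_{n\ge1}$, let $T$ be the bounded diagonal operator $Te_n=\frac1n e_n$, and let $u=\sum_{n=1}^{\infty}\sqrt{|G_n|}\,e_n$, a unit vector. Let $Q$ be the orthogonal projection onto $\mathbb{C}u$, $P=I-Q$, and $T_\perp=PTP$ (the compression of $T$ to $u^\perp$, extended by zero on $\mathbb{C}u$). *)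

theory Defs
  imports "HOL-Complex_Analysis.Complex_Analysis"
begin

section \<open>The complex Hilbert space of square-summable sequences\<close>

text \<open>The index set is \<open>{1, 2, \<dots>}\<close>; an element is stored as a function on \<^typ>\<open>nat\<close> whose
  unused value at \<open>0\<close> is \<open>0\<close>.\<close>

typedef ell2 = "{x :: nat \<Rightarrow> complex. x 0 = 0 \<and> summable (\<lambda>n. (cmod (x n))\<^sup>2)}"
  morphisms coord Abs_ell2
  by (rule exI[of _ "\<lambda>_. 0"]) simp

setup_lifting type_definition_ell2

lemma coord_0 [simp]: "coord x 0 = 0"
  using coord[of x] by simp

lemma summable_coord: "summable (\<lambda>n. (cmod (coord x n))\<^sup>2)"
  using coord[of x] by simp

lemma ell2_eqI: "(\<And>n. coord x n = coord y n) \<Longrightarrow> x = y"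
  by (metis coord_inject ext)

lemma summable_cmod_add_sq:
  assumes "summable (\<lambda>n. (cmod (x n))\<^sup>2)" "summable (\<lambda>n. (cmod (y n))\<^sup>2)"
  shows "summable (\<lambda>n. (cmod (x n + y n))\<^sup>2)"
proof (rule summable_comparison_test'[where N = 0])
  show "summable (\<lambda>n. 2 * (cmod (x n))\<^sup>2 + 2 * (cmod (y n))\<^sup>2)"
    by (intro summable_add summable_mult assms)
  fix n
  have "(cmod (x n + y n))\<^sup>2 \<le> (cmod (x n) + cmod (y n))\<^sup>2"
    by (intro power_mono norm_triangle_ineq) simp
  also have "\<dots> \<le> 2 * (cmod (x n))\<^sup>2 + 2 * (cmod (y n))\<^sup>2"
    using zero_le_power2[of "cmod (x n) - cmod (y n)"]
    by (simp add: power2_eq_square algebra_simps)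
  finally show "norm ((cmod (x n + y n))\<^sup>2) \<le> 2 * (cmod (x n))\<^sup>2 + 2 * (cmod (y n))\<^sup>2"
    by simp
qed

lemma summable_cmod_scale_sq:
  assumes "summable (\<lambda>n. (cmod (x n))\<^sup>2)"
  shows "summable (\<lambda>n. (cmod (c * x n))\<^sup>2)"
  using summable_mult[OF assms, of "(cmod c)\<^sup>2"] by (simp add: norm_mult power_mult_distrib)

lift_definition scaleC :: "complex \<Rightarrow> ell2 \<Rightarrow> ell2"  (infixr "*\<^sub>C" 75)
  is "\<lambda>c x n. c * x n"
  using summable_cmod_scale_sq by auto

lemma coord_scaleC [simp]: "coord (c *\<^sub>C x) n = c * coord x n" by transfer (rule refl)

text \<open>Linear in the first argument and conjugate-linear in the second.\<close>

definition cinner :: "ell2 \<Rightarrow> ell2 \<Rightarrow> complex"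
  where "cinner x y = (\<Sum>n. coord x n * cnj (coord y n))"

lemma summable_cinner: "summable (\<lambda>n. coord x n * cnj (coord y n))"
proof (rule summable_comparison_test'[where N = 0])
  show "summable (\<lambda>n. (cmod (coord x n))\<^sup>2 + (cmod (coord y n))\<^sup>2)"
    by (intro summable_add summable_coord)
  fix n
  have "2 * (cmod (coord x n) * cmod (coord y n)) \<le> (cmod (coord x n))\<^sup>2 + (cmod (coord y n))\<^sup>2"
    using zero_le_power2[of "cmod (coord x n) - cmod (coord y n)"]
    by (simp add: power2_eq_square algebra_simps)
  moreover have "0 \<le> cmod (coord x n) * cmod (coord y n)" by simp
  ultimately show "norm (coord x n * cnj (coord y n)) \<le> (cmod (coord x n))\<^sup>2 + (cmod (coord y n))\<^sup>2"
    by (simp only: norm_mult complex_mod_cnj)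
qed

instantiation ell2 :: real_vector
begin

lift_definition zero_ell2 :: ell2 is "\<lambda>_. 0" by simp
lift_definition plus_ell2 :: "ell2 \<Rightarrow> ell2 \<Rightarrow> ell2" is "\<lambda>x y n. x n + y n"
  using summable_cmod_add_sq by auto
lift_definition uminus_ell2 :: "ell2 \<Rightarrow> ell2" is "\<lambda>x n. - x n" by simp
definition minus_ell2 :: "ell2 \<Rightarrow> ell2 \<Rightarrow> ell2" where "minus_ell2 x y = x + (- y)"
definition scaleR_ell2 :: "real \<Rightarrow> ell2 \<Rightarrow> ell2" where "scaleR_ell2 r x = complex_of_real r *\<^sub>C x"

lemma coord_zero [simp]: "coord 0 n = 0" by transfer (rule refl)
lemma coord_add [simp]: "coord (x + y) n = coord x n + coord y n" by transfer (rule refl)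
lemma coord_uminus [simp]: "coord (- x) n = - coord x n" by transfer (rule refl)
lemma coord_diff [simp]: "coord (x - y) n = coord x n - coord y n" by (simp add: minus_ell2_def)
lemma coord_scaleR [simp]: "coord (r *\<^sub>R x) n = complex_of_real r * coord x n"
  by (simp add: scaleR_ell2_def)

instance
  by standard (rule ell2_eqI, simp add: algebra_simps)+

end

lemma cinner_self: "cinner x x = complex_of_real (\<Sum>n. (cmod (coord x n))\<^sup>2)"
  unfolding cinner_def
  using suminf_of_real[OF summable_coord[of x], where 'a = complex]
  by (simp only: complex_norm_square)

instantiation ell2 :: real_inner
begin

definition inner_ell2 :: "ell2 \<Rightarrow> ell2 \<Rightarrow> real" where "inner_ell2 x y = Re (cinner x y)"
definition norm_ell2 :: "ell2 \<Rightarrow> real" where "norm_ell2 x = sqrt (\<Sum>n. (cmod (coord x n))\<^sup>2)"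
definition dist_ell2 :: "ell2 \<Rightarrow> ell2 \<Rightarrow> real" where "dist_ell2 x y = norm (x - y)"
definition sgn_ell2 :: "ell2 \<Rightarrow> ell2" where "sgn_ell2 x = inverse (norm x) *\<^sub>R x"
definition uniformity_ell2 :: "(ell2 \<times> ell2) filter"
  where "uniformity_ell2 = (INF e\<in>{0<..}. principal {(x, y). dist x y < e})"
definition open_ell2 :: "ell2 set \<Rightarrow> bool"
  where "open_ell2 U = (\<forall>x\<in>U. eventually (\<lambda>(x', y). x' = x \<longrightarrow> y \<in> U) uniformity)"

instance
proof
  fix x y z :: ell2 and r :: real and U :: "ell2 set"
  show "dist x y = norm (x - y)" by (rule dist_ell2_def)
  show "sgn x = x /\<^sub>R norm x" by (rule sgn_ell2_def)
  show "uniformity = (INF e\<in>{0<..}. principal {(x :: ell2, y). dist x y < e})"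
    by (rule uniformity_ell2_def)
  show "open U \<longleftrightarrow> (\<forall>x\<in>U. \<forall>\<^sub>F (x', y) in uniformity. x' = x \<longrightarrow> y \<in> U)"
    by (rule open_ell2_def)
  have "cinner x y = cnj (cinner y x)"
    unfolding cinner_def
    using bounded_linear.suminf[OF bounded_linear_cnj summable_cinner[of y x]]
    by (simp add: mult.commute)
  then show "inner x y = inner y x" by (simp add: inner_ell2_def)
  have "cinner (x + y) z = cinner x z + cinner y z"
    unfolding cinner_def using suminf_add[OF summable_cinner[of x z] summable_cinner[of y z]]
    by (simp add: algebra_simps)
  then show "inner (x + y) z = inner x z + inner y z" by (simp add: inner_ell2_def)
  have "cinner (r *\<^sub>R x) y = complex_of_real r * cinner x y"
    unfolding cinner_def using suminf_mult[OF summable_cinner[of x y], of "complex_of_real r"]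
    by (simp add: mult.assoc)
  then show "inner (r *\<^sub>R x) y = r * inner x y" by (simp add: inner_ell2_def)
  have self: "inner x x = (\<Sum>n. (cmod (coord x n))\<^sup>2)" by (simp add: inner_ell2_def cinner_self)
  show "0 \<le> inner x x" unfolding self by (rule suminf_nonneg[OF summable_coord]) simp
  show "inner x x = 0 \<longleftrightarrow> x = 0"
  proof
    assume "inner x x = 0"
    then have "\<forall>n. (cmod (coord x n))\<^sup>2 = 0"
      unfolding self by (subst (asm) suminf_eq_zero_iff[OF summable_coord]) auto
    then show "x = 0" by (intro ell2_eqI) simp
  qed (simp add: inner_ell2_def cinner_def)
  show "norm x = sqrt (inner x x)" by (simp add: norm_ell2_def self)
qed

end

lemma vector_space_scaleC: "vector_space scaleC"
  by standard (rule ell2_eqI, simp add: algebra_simps)+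

lift_definition ket :: "nat \<Rightarrow> ell2"
  is "\<lambda>n k. if k = n \<and> n \<ge> 1 then 1 else 0"
proof (intro CollectI conjI)
  fix n :: nat
  show "summable (\<lambda>k. (cmod (if k = n \<and> n \<ge> 1 then 1 else 0))\<^sup>2)"
    by (rule summable_finite[of "{n}"]) auto
qed auto


section \<open>Bounded operators\<close>

definition bounded_clinear :: "(ell2 \<Rightarrow> ell2) \<Rightarrow> bool"
  where "bounded_clinear A \<longleftrightarrow> bounded_linear A \<and> (\<forall>c x. A (c *\<^sub>C x) = c *\<^sub>C A x)"

definition invertible_op :: "(ell2 \<Rightarrow> ell2) \<Rightarrow> bool"
  where "invertible_op A \<longleftrightarrow>
    bounded_clinear A \<and> (\<exists>B. bounded_clinear B \<and> B \<circ> A = id \<and> A \<circ> B = id)"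

definition spectrum :: "(ell2 \<Rightarrow> ell2) \<Rightarrow> complex set"
  where "spectrum A = {\<mu>. \<not> invertible_op (\<lambda>x. \<mu> *\<^sub>C x - A x)}"

definition is_eigenvalue :: "(ell2 \<Rightarrow> ell2) \<Rightarrow> complex \<Rightarrow> bool"
  where "is_eigenvalue A \<mu> \<longleftrightarrow> (\<exists>x. x \<noteq> 0 \<and> A x = \<mu> *\<^sub>C x)"

definition gen_eigenspace :: "(ell2 \<Rightarrow> ell2) \<Rightarrow> complex \<Rightarrow> ell2 set"
  where "gen_eigenspace A \<mu> = {x. \<exists>k. ((\<lambda>y. A y - \<mu> *\<^sub>C y) ^^ k) x = 0}"

text \<open>Algebraic multiplicity one; since the generalized eigenspace contains the eigenspace, the
  eigenspace is then a complex line as well.\<close>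

definition is_simple_eigenvalue :: "(ell2 \<Rightarrow> ell2) \<Rightarrow> complex \<Rightarrow> bool"
  where "is_simple_eigenvalue A \<mu> \<longleftrightarrow>
    is_eigenvalue A \<mu> \<and> vector_space.dim scaleC (gen_eigenspace A \<mu>) = 1"

definition orth_proj :: "ell2 set \<Rightarrow> ell2 \<Rightarrow> ell2"
  where "orth_proj M x = (THE p. p \<in> M \<and> (\<forall>m\<in>M. cinner (x - p) m = 0))"


section \<open>Gregory coefficients, the Gregory function and its completed transform\<close>

definition gregory_coeff :: "nat \<Rightarrow> complex"
  where "gregory_coeff n = fps_nth (fps_expansion (remove_sings (\<lambda>z. z / Ln (1 + z))) 0) n"

lemma gregory_coeff_sums:
  assumes "norm z < 1" "z \<noteq> 0"
  shows "(\<lambda>n. gregory_coeff n * z ^ n) sums (z / Ln (1 + z))"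
proof -
  define f where "f = (\<lambda>z :: complex. z / Ln (1 + z))"
  have pos: "1 + w \<notin> \<real>\<^sub>\<le>\<^sub>0" if "norm w < 1" for w :: complex
  proof
    assume "1 + w \<in> \<real>\<^sub>\<le>\<^sub>0"
    then have "Re (1 + w) \<le> 0" by (simp add: complex_nonpos_Reals_iff)
    moreover have "\<bar>Re w\<bar> < 1" using abs_Re_le_cmod[of w] that by linarith
    ultimately show False by simp
  qed
  have Ln_nz: "Ln (1 + w) \<noteq> 0" if "norm w < 1" "w \<noteq> 0" for w :: complex
  proof
    assume "Ln (1 + w) = 0"
    moreover have "1 + w \<noteq> 0" using pos[OF that(1)] by auto
    then have "exp (Ln (1 + w)) = 1 + w" by simp
    ultimately have "1 + w = 1" by simp
    then show False using that by simp
  qed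
  have holo: "f holomorphic_on ball 0 1 - {0}"
    unfolding f_def by (intro holomorphic_intros) (use pos Ln_nz in auto)
  then have iso: "isolated_singularity_at f 0"
    by (intro isolated_singularity_at_holomorphic[of _ "ball 0 1"]) auto
  have "((\<lambda>w. Ln (1 + w)) has_field_derivative 1) (at 0)"
    by (auto intro!: derivative_eq_intros)
  then have "(\<lambda>w. Ln (1 + w) / w) \<midarrow>0\<rightarrow> 1"
    by (simp add: has_field_derivative_iff)
  then have "(\<lambda>w. inverse (Ln (1 + w) / w)) \<midarrow>0\<rightarrow> inverse 1"
    by (rule tendsto_inverse) simp
  then have lim: "f \<midarrow>0\<rightarrow> 1" by (simp add: f_def)
  have ana0: "remove_sings f analytic_on {0}"
    by (rule remove_sings_analytic_at[OF iso lim])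
  have ana: "f analytic_on ball 0 1 - {0}"
    using holo by (subst analytic_on_open) auto
  have "remove_sings f analytic_on {0} \<union> (ball 0 1 - {0})"
    using ana0 remove_sings_analytic_on[OF ana] analytic_on_Un by blast
  then have "remove_sings f holomorphic_on ball 0 1"
    by (rule analytic_imp_holomorphic[OF analytic_on_subset]) auto
  then have "(\<lambda>n. (deriv ^^ n) (remove_sings f) 0 / fact n * (z - 0) ^ n) sums remove_sings f z"
    by (rule holomorphic_power_series) (use assms in auto)
  moreover have "f analytic_on {z}"
    by (rule analytic_on_subset[OF ana]) (use assms in auto)
  then have "remove_sings f z = f z" by (rule remove_sings_at_analytic)
  ultimately show ?thesis
    by (simp add: gregory_coeff_def fps_expansion_def f_def)
qed

definition gregory_fun :: "complex \<Rightarrow> complex"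
  where "gregory_fun z = rGamma (z + 1) *
    integral {0..1} (\<lambda>x :: real. Gamma (of_real x + 1) * rGamma (of_real x - z + 1))"

text \<open>\<^const>\<open>remove_sings\<close> supplies the limit values at the nonpositive integers. The values at
  the poles \<open>1, 2, \<dots>\<close> are irrelevant.\<close>

definition gregory_transform :: "complex \<Rightarrow> complex"
  where "gregory_transform = remove_sings (\<lambda>z. of_real pi * z / sin (of_real pi * z) * gregory_fun z)"

definition gregory_zero :: "nat \<Rightarrow> real"
  where "gregory_zero n =
    (THE x. real n < x \<and> x < real n + 1 \<and> gregory_transform (of_real x) = 0)"


section \<open>The operators\<close>

lift_definition T_op :: "ell2 \<Rightarrow> ell2"
  is "\<lambda>x n. x n / of_nat n"
proof (intro CollectI conjI)
  fix x :: "nat \<Rightarrow> complex"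
  assume "x 0 = 0 \<and> summable (\<lambda>n. (cmod (x n))\<^sup>2)"
  then have s: "summable (\<lambda>n. (cmod (x n))\<^sup>2)" by simp
  show "summable (\<lambda>n. (cmod (x n / of_nat n))\<^sup>2)"
  proof (rule summable_comparison_test'[OF s, where N = 1])
    fix n :: nat
    assume "n \<ge> 1"
    then have "cmod (x n) / real n \<le> cmod (x n) / 1"
      by (intro divide_left_mono) auto
    then show "norm ((cmod (x n / of_nat n))\<^sup>2) \<le> (cmod (x n))\<^sup>2"
      by (simp add: norm_divide power_mono)
  qed
qed simp

lemma T_op_ket: "T_op (ket n) = (1 / of_nat n) *\<^sub>C ket n"
  by transfer (auto simp: fun_eq_iff)

definition u_vec :: ell2
  where "u_vec = (\<Sum>\<^sub>\<infinity>n\<in>{1..}. complex_of_real (sqrt (cmod (gregory_coeff n))) *\<^sub>C ket n)"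

definition Q_op :: "ell2 \<Rightarrow> ell2"
  where "Q_op = orth_proj (module.span scaleC {u_vec})"

definition P_op :: "ell2 \<Rightarrow> ell2"
  where "P_op x = x - Q_op x"

definition T_perp :: "ell2 \<Rightarrow> ell2"
  where "T_perp = P_op \<circ> T_op \<circ> P_op"

end

theory Submission
  imports Defs
begin

text \<open>For \<open>0 < x < 1\<close> the Beta integral with the binomial series of \<open>(1 - t) powr (x - 1)\<close>
  inserted gives
  \<open>\<Gamma>(1 - z) \<Gamma>(x + 1) / \<Gamma>(x + 1 - z) = \<Sum>\<^sub>n n \<bar>x choose n\<bar> / (n - z)\<close>, first for real \<open>z < 1\<close> and then
  off the positive integers by analytic continuation. Integrating over \<open>x\<close>, and using that
  \<open>G\<^sub>n\<close> is the integral of \<open>x choose n\<close>, yields \<open>H(z) = \<Sum>\<^sub>n n \<bar>G\<^sub>n\<bar> / (n - z)\<close>, which is the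
  quadratic form of the resolvent at \<open>u\<close>. As all weights are positive, the zeros of \<open>H\<close> are real,
  and there is exactly one in each \<open>(n, n + 1)\<close> and no other.

  For \<open>y\<close> orthogonal to \<open>u\<close>, the equation \<open>(1/z - PTP) x = y\<close> amounts to
  \<open>(I - z T) x = z y - c u\<close>, where the scalar \<open>c\<close> is determined by requiring \<open>x\<close> to be orthogonal
  to \<open>u\<close>. This is uniquely solvable unless \<open>H(z) = 0\<close>, in which case the kernel is spanned by
  \<open>R u\<close> with \<open>(I - z T) R u = u\<close>; self-adjointness excludes generalized eigenvectors.\<close>

section \<open>Operators on the sequence space\<close>

lemma cinner_commute: "cinner y x = cnj (cinner x y)"
  unfolding cinner_def
  using bounded_linear.suminf[OF bounded_linear_cnj summable_cinner[of x y]]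
  by (simp add: mult.commute)

lemma cinner_add_left: "cinner (x + y) z = cinner x z + cinner y z"
  unfolding cinner_def using suminf_add[OF summable_cinner[of x z] summable_cinner[of y z]]
  by (simp add: algebra_simps)

lemma cinner_scaleC_left [simp]: "cinner (c *\<^sub>C x) y = c * cinner x y"
  unfolding cinner_def using suminf_mult[OF summable_cinner[of x y], of c]
  by (simp add: mult.assoc)

lemma cinner_diff_left: "cinner (x - y) z = cinner x z - cinner y z"
  using cinner_add_left[of "x - y" y z] by (simp add: algebra_simps)

lemma cinner_diff_right: "cinner z (x - y) = cinner z x - cinner z y"
  by (metis cinner_commute cinner_diff_left complex_cnj_diff)

lemma cinner_scaleC_right [simp]: "cinner x (c *\<^sub>C y) = cnj c * cinner x y"
  by (metis cinner_commute cinner_scaleC_left complex_cnj_mult)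

lemma cinner_zero_left [simp]: "cinner 0 x = 0"
  by (simp add: cinner_def)

lemma cinner_norm: "cinner x x = (of_real (norm x))\<^sup>2"
proof -
  have "0 \<le> (\<Sum>n. (cmod (coord x n))\<^sup>2)"
    by (intro suminf_nonneg summable_coord) auto
  then show ?thesis
    by (simp add: cinner_self norm_ell2_def flip: of_real_power)
qed

lemma coord_ket: "coord (ket n) k = (if k = n \<and> n \<ge> 1 then 1 else 0)"
  by transfer simp

lemma cinner_ket [simp]: "cinner x (ket n) = coord x n"
proof -
  have "(\<lambda>k. coord x k * cnj (coord (ket n) k)) sums
    (\<Sum>k\<in>{n}. coord x k * cnj (coord (ket n) k))"
    by (rule sums_finite) (auto simp: coord_ket)
  then show ?thesis
    by (cases "n = 0") (auto simp: cinner_def coord_ket sums_iff)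
qed

lemma cinner_ket_left [simp]: "cinner (ket n) x = cnj (coord x n)"
  by (metis cinner_commute cinner_ket)

lemma norm_scaleC [simp]: "norm (c *\<^sub>C x) = cmod c * norm x"
proof -
  have "of_real ((norm (c *\<^sub>C x))\<^sup>2) = c * cnj c * cinner x x"
    using cinner_norm[of "c *\<^sub>C x"] by (simp add: mult_ac)
  also have "\<dots> = of_real ((cmod c * norm x)\<^sup>2)"
    by (simp add: cinner_norm power_mult_distrib flip: complex_norm_square)
  finally have "of_real ((norm (c *\<^sub>C x))\<^sup>2) = (of_real ((cmod c * norm x)\<^sup>2) :: complex)" .
  then have "(norm (c *\<^sub>C x))\<^sup>2 = (cmod c * norm x)\<^sup>2"
    by (simp only: of_real_eq_iff)
  then show ?thesis
    by (simp add: power2_eq_iff_nonneg)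
qed

text \<open>A unimodular factor \<open>c\<close> rotates \<open>cinner x y\<close> onto its modulus,
  which is then the real inner product of \<open>c *\<^sub>C x\<close> and \<open>y\<close>; the
  real inequality applies to that.\<close>

lemma cinner_Cauchy_Schwarz: "cmod (cinner x y) \<le> norm x * norm y"
proof (cases "cinner x y = 0")
  case False
  define c where "c = cnj (cinner x y) / cmod (cinner x y)"
  have "cmod c = 1"
    using False by (simp add: c_def norm_divide)
  have "c * cinner x y = cmod (cinner x y)"
    using False complex_norm_square[of "cinner x y"]
    by (simp add: c_def field_simps power2_eq_square)
  then have "cmod (cinner x y) = inner (c *\<^sub>C x) y"
    by (simp add: inner_ell2_def)
  also have "\<dots> \<le> norm (c *\<^sub>C x) * norm y"
    by (rule norm_cauchy_schwarz)
  finally show ?thesis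
    using \<open>cmod c = 1\<close> by simp
qed simp

section \<open>Bounded complex-linear maps and a criterion for invertibility\<close>

lemma scaleR_scaleC: "r *\<^sub>R x = complex_of_real r *\<^sub>C x"
  by (rule scaleR_ell2_def)

lemma bounded_clinearI:
  assumes "\<And>x y. A (x + y) = A x + A y" "\<And>c x. A (c *\<^sub>C x) = c *\<^sub>C A x"
    "\<And>x. norm (A x) \<le> norm x * K"
  shows "bounded_clinear A"
  unfolding bounded_clinear_def
  by (intro conjI bounded_linear_intro[where K = K]) (use assms in \<open>auto simp: scaleR_scaleC\<close>)

lemma bounded_clinear_id: "bounded_clinear (\<lambda>x. x)"
  by (simp add: bounded_clinear_def)

lemma bounded_clinear_compose:
  "bounded_clinear A \<Longrightarrow> bounded_clinear B \<Longrightarrow> bounded_clinear (\<lambda>x. A (B x))"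
  by (auto simp: bounded_clinear_def bounded_linear_compose)

lemma scaleC_add_right: "c *\<^sub>C (x + y) = c *\<^sub>C x + c *\<^sub>C y"
  and scaleC_diff_right: "c *\<^sub>C (x - y) = c *\<^sub>C x - c *\<^sub>C y"
  and scaleC_add_left: "(c + d) *\<^sub>C x = c *\<^sub>C x + d *\<^sub>C x"
  and scaleC_scaleC [simp]: "c *\<^sub>C d *\<^sub>C x = (c * d) *\<^sub>C x"
  and scaleC_one [simp]: "1 *\<^sub>C x = x"
  and scaleC_zero_left [simp]: "0 *\<^sub>C x = 0"
  and scaleC_zero_right [simp]: "c *\<^sub>C 0 = 0"
  by (rule ell2_eqI, simp add: algebra_simps)+

lemma bounded_clinear_add:
  "bounded_clinear A \<Longrightarrow> bounded_clinear B \<Longrightarrow> bounded_clinear (\<lambda>x. A x + B x)"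
  by (auto simp: bounded_clinear_def bounded_linear_add scaleC_add_right)

lemma bounded_clinear_diff:
  "bounded_clinear A \<Longrightarrow> bounded_clinear B \<Longrightarrow> bounded_clinear (\<lambda>x. A x - B x)"
  by (auto simp: bounded_clinear_def bounded_linear_sub scaleC_diff_right)

lemma bounded_clinear_rank_one: "bounded_clinear (\<lambda>x. cinner x v *\<^sub>C w)"
proof (rule bounded_clinearI)
  fix x
  show "norm (cinner x v *\<^sub>C w) \<le> norm x * (norm v * norm w)"
    using mult_right_mono[OF cinner_Cauchy_Schwarz[of x v] norm_ge_zero[of w]] by (simp add: mult.assoc)
qed (auto simp: cinner_add_left scaleC_add_left)

lemma bounded_clinear_scaleC: "bounded_clinear (\<lambda>x. c *\<^sub>C x)"
  by (rule bounded_clinearI[where K = "cmod c"]) (auto simp: scaleC_add_right mult.commute)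

lemmas bounded_clinear_intros = bounded_clinear_id bounded_clinear_add bounded_clinear_diff
  bounded_clinear_compose[OF bounded_clinear_scaleC]

lemma bounded_clinear_simps:
  assumes "bounded_clinear A"
  shows "A (x + y) = A x + A y" "A (x - y) = A x - A y" "A (c *\<^sub>C x) = c *\<^sub>C A x" "A 0 = 0"
proof -
  interpret bounded_linear A
    using assms by (simp add: bounded_clinear_def)
  show "A (x + y) = A x + A y" "A (x - y) = A x - A y" "A (c *\<^sub>C x) = c *\<^sub>C A x" "A 0 = 0"
    using assms by (simp_all add: add diff bounded_clinear_def)
qed

text \<open>The trivial kernel makes the right inverse two-sided, since \<open>A\<close> annihilates
  \<open>B (A x) - x\<close>. Thus inverses constructed below are checked on one side only.\<close>

lemma invertible_opI:
  assumes A: "bounded_clinear A" and B: "bounded_clinear B"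
    and AB: "\<And>y. A (B y) = y" and ker: "\<And>x. A x = 0 \<Longrightarrow> x = 0"
  shows "invertible_op A"
proof -
  have "B (A x) = x" for x
    using ker[of "B (A x) - x"] AB by (simp add: bounded_clinear_simps[OF A])
  then show ?thesis
    unfolding invertible_op_def using A B AB by (auto simp: fun_eq_iff)
qed

lemma invertible_op_imp_inj: "invertible_op A \<Longrightarrow> inj A"
  unfolding invertible_op_def by (metis inj_on_id inj_on_imageI2)

text \<open>The boundedness test makes the definition total: an unbounded \<open>m\<close> yields
  the zero operator, so the result is square-summable for every \<open>m\<close>.\<close>

lift_definition diag_op :: "(nat \<Rightarrow> complex) \<Rightarrow> ell2 \<Rightarrow> ell2"
  is "\<lambda>m x n. if bounded (range m) then m n * x n else 0"
proof (intro CollectI conjI)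
  fix m x :: "nat \<Rightarrow> complex"
  assume x: "x 0 = 0 \<and> summable (\<lambda>n. (cmod (x n))\<^sup>2)"
  show "summable (\<lambda>n. (cmod (if bounded (range m) then m n * x n else 0))\<^sup>2)"
  proof (cases "bounded (range m)")
    case True
    then obtain K where K: "\<And>n. cmod (m n) \<le> K"
      by (auto simp: bounded_iff)
    show ?thesis
    proof (rule summable_comparison_test'[where N = 0])
      show "summable (\<lambda>n. K\<^sup>2 * (cmod (x n))\<^sup>2)"
        using x by (intro summable_mult) auto
      show "norm ((cmod (if bounded (range m) then m n * x n else 0))\<^sup>2) \<le> K\<^sup>2 * (cmod (x n))\<^sup>2" for n
        using True K[of n] by (auto simp: norm_mult power_mult_distrib intro!: mult_right_mono power_mono)
    qed
  qed simp
qed auto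

lemma coord_diag_op: "bounded (range m) \<Longrightarrow> coord (diag_op m x) n = m n * coord x n"
  by transfer simp

lemma norm_le_coord:
  assumes "\<And>n. cmod (coord x n) \<le> K * cmod (coord y n)" "K \<ge> 0"
  shows "norm x \<le> K * norm y"
proof -
  have "(\<Sum>n. (cmod (coord x n))\<^sup>2) \<le> (\<Sum>n. K\<^sup>2 * (cmod (coord y n))\<^sup>2)"
  proof (intro suminf_le summable_mult summable_coord)
    show "(cmod (coord x n))\<^sup>2 \<le> K\<^sup>2 * (cmod (coord y n))\<^sup>2" for n
      using power_mono[OF assms(1)[of n], of 2] by (simp add: power_mult_distrib)
  qed
  also have "\<dots> = K\<^sup>2 * (\<Sum>n. (cmod (coord y n))\<^sup>2)"
    by (intro suminf_mult summable_coord)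
  finally have "norm x \<le> sqrt (K\<^sup>2 * (\<Sum>n. (cmod (coord y n))\<^sup>2))"
    by (simp add: norm_ell2_def)
  then show ?thesis
    using assms(2) by (simp add: norm_ell2_def real_sqrt_mult)
qed

lemma bounded_clinear_diag_op:
  assumes "bounded (range m)"
  shows "bounded_clinear (diag_op m)"
proof -
  obtain K where K: "\<And>n. cmod (m n) \<le> K"
    using assms by (auto simp: bounded_iff)
  then have "0 \<le> K"
    using norm_ge_zero[of "m 0"] by (metis order_trans)
  show ?thesis
  proof (rule bounded_clinearI)
    show "norm (diag_op m x) \<le> norm x * K" for x
      using norm_le_coord[of "diag_op m x" K x] K \<open>0 \<le> K\<close>
      by (simp add: coord_diag_op[OF assms] norm_mult mult_right_mono mult.commute)
  qed (auto intro!: ell2_eqI simp: coord_diag_op[OF assms] algebra_simps)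
qed

lemma coord_T_op [simp]: "coord (T_op x) n = coord x n / of_nat n"
  by transfer simp

lemma bounded_clinear_T_op: "bounded_clinear T_op"
proof (rule bounded_clinearI)
  have "cmod (coord x n) / real n \<le> 1 * cmod (coord x n)" for x n
    by (cases "n = 0") (auto simp: divide_le_eq mult_le_cancel_left1)
  then show "norm (T_op x) \<le> norm x * 1" for x
    using norm_le_coord[of "T_op x" 1 x] by (simp add: norm_divide)
qed (auto intro!: ell2_eqI simp: add_divide_distrib)

lemma cinner_T_op: "cinner (T_op x) y = cinner x (T_op y)"
  by (simp add: cinner_def)

text \<open>Orthogonality of \<open>x - p\<close> to \<open>u\<close> itself already determines the
  coefficient of \<open>p\<close>.\<close>

lemma orth_proj_span_unit:
  assumes "norm u = 1"
  shows "orth_proj (module.span scaleC {u}) x = cinner x u *\<^sub>C u"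
proof -
  interpret vector_space scaleC
    by (rule vector_space_scaleC)
  have uu: "cinner u u = 1"
    using assms by (simp add: cinner_norm)
  show ?thesis
    unfolding orth_proj_def span_singleton
  proof (rule the_equality)
    fix p
    assume "p \<in> range (\<lambda>k. k *\<^sub>C u) \<and> (\<forall>m\<in>range (\<lambda>k. k *\<^sub>C u). cinner (x - p) m = 0)"
    then obtain k where k: "p = k *\<^sub>C u" and "cinner (x - p) (1 *\<^sub>C u) = 0"
      by blast
    then have "cinner x u = k"
      using uu by (simp add: cinner_diff_left)
    then show "p = cinner x u *\<^sub>C u"
      using k by simp
  qed (use uu in \<open>auto simp: cinner_diff_left\<close>)
qed

text \<open>By Pythagoras, the partial sum over \<open>F\<close> misses \<open>v\<close> by the
  square root of the mass of \<open>q\<close> outside \<open>F\<close>, and this tends to 0. The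
  unordered sum is the form in which \<open>u_vec\<close> is defined.\<close>

lemma has_sum_ket: "((\<lambda>n. coord v n *\<^sub>C ket n) has_sum v) {1..}"
proof -
  define q where "q n = (cmod (coord v n))\<^sup>2" for n
  have "q sums suminf q"
    unfolding q_def by (intro summable_sums summable_coord)
  have "(q has_sum suminf q) UNIV"
    by (rule norm_summable_imp_has_sum[OF _ \<open>q sums suminf q\<close>]) (simp add: q_def summable_coord)
  then have "(q has_sum suminf q) {1..}"
    by (subst has_sum_cong_neutral[where T = UNIV and g = q]) (auto simp: q_def Suc_le_eq)
  then have "((\<lambda>F. sqrt (suminf q - sum q F)) \<longlongrightarrow> sqrt (suminf q - suminf q)) (finite_subsets_at_top {1..})"
    unfolding has_sum_def by (intro tendsto_intros)
  moreover have "sqrt (suminf q - sum q F) = dist (\<Sum>n\<in>F. coord v n *\<^sub>C ket n) v" if F: "finite F" "F \<subseteq> {1..}" for F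
  proof -
    have add: "coord (\<Sum>n\<in>F. coord v n *\<^sub>C ket n) m = (\<Sum>n\<in>F. coord v n * coord (ket n) m)" for m
      by (induction F rule: infinite_finite_induct) auto
    have "coord (v - (\<Sum>n\<in>F. coord v n *\<^sub>C ket n)) m = (if m \<in> F then 0 else coord v m)" for m
    proof -
      have "(\<Sum>n\<in>F. coord v n * coord (ket n) m) = (\<Sum>n\<in>F. if n = m then coord v m else 0)"
        using F by (intro sum.cong) (auto simp: coord_ket)
      then show ?thesis
        using F by (simp add: add)
    qed
    then have "(\<lambda>m. (cmod (coord (v - (\<Sum>n\<in>F. coord v n *\<^sub>C ket n)) m))\<^sup>2) = (\<lambda>m. q m - (if m \<in> F then q m else 0))"
      by (auto simp: q_def)
    moreover have "(\<lambda>m. q m - (if m \<in> F then q m else 0)) sums (suminf q - sum q F)"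
      by (intro sums_diff \<open>q sums suminf q\<close> sums_If_finite_set F)
    ultimately have "norm (v - (\<Sum>n\<in>F. coord v n *\<^sub>C ket n)) = sqrt (suminf q - sum q F)"
      by (simp add: norm_ell2_def sums_iff)
    then show ?thesis
      by (simp add: dist_norm norm_minus_commute)
  qed
  then have "\<forall>\<^sub>F F in finite_subsets_at_top {1..}.
      sqrt (suminf q - sum q F) = dist (\<Sum>n\<in>F. coord v n *\<^sub>C ket n) v"
    by (intro eventually_finite_subsets_at_top_weakI)
  ultimately have "((\<lambda>F. dist (\<Sum>n\<in>F. coord v n *\<^sub>C ket n) v) \<longlongrightarrow> 0) (finite_subsets_at_top {1..})"
    by (simp add: tendsto_cong)
  then show ?thesis
    unfolding has_sum_def by (subst tendsto_dist_iff)
qed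

section \<open>Compression to the complement of a unit vector\<close>

text \<open>The spectral analysis works for any unit vector; the Gregory coefficients enter only
  through an interpretation in the last section.\<close>

locale unit_vector =
  fixes u :: ell2
  assumes norm_u: "norm u = 1"
begin

definition proj :: "ell2 \<Rightarrow> ell2"
  where "proj x = x - cinner x u *\<^sub>C u"

text \<open>The operator \<open>P T P\<close>; for \<open>u = u_vec\<close> it is
  \<open>T_perp\<close>.\<close>

definition compress :: "ell2 \<Rightarrow> ell2"
  where "compress x = proj (T_op (proj x))"

lemma cinner_u [simp]: "cinner u u = 1"
  using norm_u by (simp add: cinner_norm)

lemma cinner_proj [simp]: "cinner (proj x) u = 0"
  by (simp add: proj_def cinner_diff_left)

lemma bounded_clinear_proj: "bounded_clinear proj"
  unfolding proj_def[abs_def] by (intro bounded_clinear_intros bounded_clinear_rank_one)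

lemma bounded_clinear_compress: "bounded_clinear compress"
  unfolding compress_def[abs_def]
  by (intro bounded_clinear_compose[OF bounded_clinear_proj]
      bounded_clinear_compose[OF bounded_clinear_T_op] bounded_clinear_proj)

lemma proj_decomp: "x = cinner x u *\<^sub>C u + proj x"
  by (simp add: proj_def)

lemma proj_id: "cinner x u = 0 \<Longrightarrow> proj x = x"
  by (simp add: proj_def)

lemma cinner_proj_left: "cinner (proj x) y = cinner x (proj y)"
  using cinner_commute[of u y]
  by (simp add: proj_def cinner_diff_left cinner_diff_right)

lemma cinner_compress: "cinner (compress x) y = cinner x (compress y)"
  by (simp add: compress_def cinner_proj_left cinner_T_op)

text \<open>Pairing the equation with \<open>u\<close> forces
  \<open>c = z * cinner (T_op x) u\<close>, so the term \<open>c *\<^sub>C u\<close> is exactly the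
  component that the outer projection removes.\<close>

lemma compress_solution:
  assumes "z \<noteq> 0" "cinner x u = 0" "cinner y u = 0" "x - z *\<^sub>C T_op x = z *\<^sub>C y - c *\<^sub>C u"
  shows "(1 / z) *\<^sub>C x - compress x = y"
proof -
  have "cinner (x - z *\<^sub>C T_op x) u = cinner (z *\<^sub>C y - c *\<^sub>C u) u"
    using assms(4) by simp
  then have c: "c = z * cinner (T_op x) u"
    using assms(2,3) by (simp add: cinner_diff_left)
  show ?thesis
  proof (rule ell2_eqI)
    fix n
    have "coord (x - z *\<^sub>C T_op x) n = coord (z *\<^sub>C y - c *\<^sub>C u) n"
      using assms(4) by simp
    then show "coord ((1 / z) *\<^sub>C x - compress x) n = coord y n"
      using \<open>z \<noteq> 0\<close> by (simp add: compress_def proj_id[OF assms(2)] c proj_def[of "T_op x"] field_simps)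
  qed
qed

text \<open>The range of \<open>compress\<close> is orthogonal to \<open>u\<close>, hence so is
  \<open>x = z *\<^sub>C compress x\<close>. The inner projection then does nothing, and the outer
  one changes \<open>T_op x\<close> only by a multiple of \<open>u\<close>.\<close>

lemma compress_kernel:
  assumes "z \<noteq> 0" "(1 / z) *\<^sub>C x - compress x = 0"
  obtains c where "cinner x u = 0" "x - z *\<^sub>C T_op x = c *\<^sub>C u"
proof -
  have "cinner ((1 / z) *\<^sub>C x - compress x) u = 0"
    using assms(2) by simp
  then have xu: "cinner x u = 0"
    using assms(1) by (simp add: cinner_diff_left compress_def)
  have "x - z *\<^sub>C T_op x = (- z * cinner (T_op x) u) *\<^sub>C u"
  proof (rule ell2_eqI)
    fix n
    have "coord ((1 / z) *\<^sub>C x - compress x) n = 0"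
      using assms(2) by simp
    then show "coord (x - z *\<^sub>C T_op x) n = coord ((- z * cinner (T_op x) u) *\<^sub>C u) n"
      using \<open>z \<noteq> 0\<close> by (simp add: compress_def proj_id[OF xu] proj_def[of "T_op x"] field_simps)
  qed
  then show thesis
    using xu that by blast
qed

text \<open>It suffices to solve the equation inside the complement of \<open>u\<close>, which is
  done by \<open>S\<close>. On the line through \<open>u\<close>, where \<open>compress\<close>
  vanishes, the inverse is multiplication by \<open>z\<close>; the two inverses are glued along the
  orthogonal decomposition.\<close>

lemma compress_invertible:
  assumes "z \<noteq> 0" "bounded_clinear S" "\<And>y. cinner (S y) u = 0"
    and eq: "\<And>y. S y - z *\<^sub>C T_op (S y) = z *\<^sub>C y - c y *\<^sub>C u"
    and ker: "\<And>x c. cinner x u = 0 \<Longrightarrow> x - z *\<^sub>C T_op x = c *\<^sub>C u \<Longrightarrow> x = 0"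
  shows "invertible_op (\<lambda>x. (1 / z) *\<^sub>C x - compress x)"
proof (rule invertible_opI)
  show "bounded_clinear (\<lambda>x. (1 / z) *\<^sub>C x - compress x)"
    by (intro bounded_clinear_intros bounded_clinear_compress)
  show "bounded_clinear (\<lambda>y. z *\<^sub>C cinner y u *\<^sub>C u + S (proj y))"
    by (intro bounded_clinear_intros bounded_clinear_rank_one
        bounded_clinear_compose[OF assms(2)] bounded_clinear_proj)
  show "x = 0" if "(1 / z) *\<^sub>C x - compress x = 0" for x
    using compress_kernel[OF assms(1) that] ker by metis
  show "(1 / z) *\<^sub>C (z *\<^sub>C cinner y u *\<^sub>C u + S (proj y)) -
      compress (z *\<^sub>C cinner y u *\<^sub>C u + S (proj y)) = y" for y
  proof -
    have "(1 / z) *\<^sub>C S (proj y) - compress (S (proj y)) = proj y"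
      by (rule compress_solution[OF _ _ _ eq]) (use assms in auto)
    moreover have "compress u = 0"
      by (simp add: compress_def proj_def[of u] bounded_clinear_simps[OF bounded_clinear_T_op]
          bounded_clinear_simps[OF bounded_clinear_proj])
    ultimately show ?thesis
      using assms(1) proj_decomp[of y]
      by (simp add: bounded_clinear_simps[OF bounded_clinear_compress] scaleC_add_right algebra_simps)
  qed
qed

end

text \<open>The resolvent \<open>(I - z T)^(-1)\<close>: its entry \<open>1 / (1 - z / n)\<close> is
  written as a single fraction, which vanishes at index 0.\<close>

definition T_res :: "complex \<Rightarrow> ell2 \<Rightarrow> ell2"
  where "T_res z = diag_op (\<lambda>n. of_nat n / (of_nat n - z))"

text \<open>For \<open>z = n\<close> the \<open>n\<close>-th entry is \<open>n / 0 = 0\<close>, so the bound holds there as well.\<close>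

lemma bounded_T_res: "bounded (range (\<lambda>n. of_nat n / (of_nat n - z :: complex)))"
proof -
  have "(\<lambda>n. of_nat n / (of_nat n - z :: complex)) \<longlonglongrightarrow> 1"
  proof -
    have "(\<lambda>n. inverse (1 - z * (inverse (of_nat n)))) \<longlonglongrightarrow> inverse (1 - z * 0)"
      by (intro tendsto_intros lim_inverse_n) auto
    moreover have "\<forall>\<^sub>F n in sequentially. inverse (1 - z * (inverse (of_nat n))) = of_nat n / (of_nat n - z)"
      using eventually_gt_at_top[of 0]
      by eventually_elim (auto simp: field_simps)
    ultimately show ?thesis
      by (simp add: tendsto_cong)
  qed
  then show ?thesis
    by (intro convergent_imp_bounded)
qed

lemmas coord_T_res [simp] = coord_diag_op[OF bounded_T_res, folded T_res_def]

lemma bounded_clinear_T_res: "bounded_clinear (T_res z)"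
  unfolding T_res_def by (intro bounded_clinear_diag_op bounded_T_res)

lemma resolvent_entry: "a \<noteq> 0 \<Longrightarrow> a \<noteq> z \<Longrightarrow> a / (a - z) * y - z * (a / (a - z) * y / a) = y"
  for a :: complex
  by (simp add: divide_simps) (simp add: algebra_simps)

lemma T_res_right:
  assumes "z \<notin> of_nat ` {1..}"
  shows "T_res z y - z *\<^sub>C T_op (T_res z y) = y"
proof (rule ell2_eqI)
  fix n
  show "coord (T_res z y - z *\<^sub>C T_op (T_res z y)) n = coord y n"
  proof (cases "n = 0")
    case False
    then have "of_nat n - z \<noteq> 0"
      using assms by (force simp: image_iff)
    then show ?thesis
      using False resolvent_entry[of "of_nat n" z "coord y n"]
      by (simp only: coord_diff coord_scaleC coord_T_op coord_T_res) simp
  qed simp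
qed

lemma T_res_left:
  assumes "z \<notin> of_nat ` {1..}"
  shows "T_res z (y - z *\<^sub>C T_op y) = y"
proof -
  have "T_res z (y - z *\<^sub>C T_op y) = T_res z y - z *\<^sub>C T_op (T_res z y)"
    by (rule ell2_eqI) (simp add: algebra_simps)
  then show ?thesis
    using T_res_right[OF assms] by simp
qed

lemma invertible_op_T_op:
  assumes "z \<notin> of_nat ` {1..}"
  shows "invertible_op (\<lambda>x. x - z *\<^sub>C T_op x)" "inv (\<lambda>x. x - z *\<^sub>C T_op x) = T_res z"
proof -
  show "invertible_op (\<lambda>x. x - z *\<^sub>C T_op x)"
    by (rule invertible_opI[OF _ bounded_clinear_T_res T_res_right[OF assms]])
       (intro bounded_clinear_intros bounded_clinear_T_op,
        metis T_res_left[OF assms] bounded_clinear_simps(4)[OF bounded_clinear_T_res])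
  show "inv (\<lambda>x. x - z *\<^sub>C T_op x) = T_res z"
    by (rule inv_unique_comp) (auto simp: fun_eq_iff T_res_right[OF assms] T_res_left[OF assms])
qed

section \<open>Inverses and eigenvectors of the compression\<close>

context unit_vector
begin

lemma compress_invertible_regular:
  assumes z: "z \<noteq> 0" "z \<notin> of_nat ` {1..}" and H: "cinner (T_res z u) u \<noteq> 0"
  shows "invertible_op (\<lambda>x. (1 / z) *\<^sub>C x - compress x)"
proof -
  define h where "h = cinner (T_res z u) u"
  \<comment> \<open>Subtracting a multiple of \<open>T_res z u\<close> alters the image under
    \<open>I - z T\<close> only by a multiple of \<open>u\<close>, which the equation allows. The
    coefficient is the one that makes \<open>S y\<close> orthogonal to \<open>u\<close>; it exists
    because \<open>h\<close> is nonzero.\<close>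
  define S where "S = (\<lambda>y. z *\<^sub>C T_res z y - ((z / h) *\<^sub>C cinner (T_res z y) u *\<^sub>C T_res z u))"
  have "bounded_clinear (\<lambda>x. x - z *\<^sub>C T_op x)"
    by (intro bounded_clinear_intros bounded_clinear_T_op)
  note L = bounded_clinear_simps(2,3)[OF this]
  show ?thesis
  proof (rule compress_invertible)
    show "bounded_clinear S"
      unfolding S_def by (intro bounded_clinear_intros bounded_clinear_T_res
        bounded_clinear_compose[OF bounded_clinear_rank_one])
    show "cinner (S y) u = 0" for y
      using H by (simp add: S_def cinner_diff_left h_def)
    show "S y - z *\<^sub>C T_op (S y) = z *\<^sub>C y - (z / h * cinner (T_res z y) u) *\<^sub>C u" for y
    proof -
      have "S y - z *\<^sub>C T_op (S y) = z *\<^sub>C (T_res z y - z *\<^sub>C T_op (T_res z y)) -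
          (z / h * cinner (T_res z y) u) *\<^sub>C (T_res z u - z *\<^sub>C T_op (T_res z u))"
        unfolding S_def by (simp only: L scaleC_scaleC cinner_ket)
      then show ?thesis
        by (simp add: T_res_right[OF z(2)])
    qed
    \<comment> \<open>Kernel elements are multiples \<open>c\<close> of \<open>T_res z u\<close>,
      and orthogonality to \<open>u\<close> then reads \<open>c * h = 0\<close>.\<close>
    fix x c
    assume "cinner x u = 0" "x - z *\<^sub>C T_op x = c *\<^sub>C u"
    moreover from this have "x = c *\<^sub>C T_res z u"
      using T_res_left[OF z(2), of x] by (simp add: bounded_clinear_simps[OF bounded_clinear_T_res])
    ultimately show "x = 0"
      using H by auto
  qed (use z in auto)
qed

text \<open>At a pole \<open>z = N\<close> the operator \<open>I - N T\<close> annihilates \<open>e\<^sub>N\<close> and misses only the \<open>N\<close>-th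
  coordinate; both defects are absorbed by \<open>u\<close> since its \<open>N\<close>-th coordinate is nonzero.\<close>

lemma compress_invertible_pole:
  fixes N :: nat
  assumes N: "N \<ge> 1" and uN: "coord u N \<noteq> 0"
  shows "invertible_op (\<lambda>x. (1 / of_nat N) *\<^sub>C x - compress x)"
proof -
  define z :: complex where "z = of_nat N"
  have z: "z \<noteq> 0"
    using N by (simp add: z_def)
  \<comment> \<open>The right-hand side is corrected by the multiple of \<open>u\<close> that
    cancels its \<open>N\<close>-th coordinate, which puts it in the range of
    \<open>I - N T\<close>.\<close>
  define S0 where "S0 = (\<lambda>y. z *\<^sub>C T_res z y - (z / coord u N) *\<^sub>C cinner y (ket N) *\<^sub>C T_res z u)"
  \<comment> \<open>A multiple of \<open>ket N\<close>, which lies in the kernel of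
    \<open>I - N T\<close>, restores orthogonality to \<open>u\<close>; the divisor is
    \<open>cinner (ket N) u\<close>.\<close>
  define S where "S = (\<lambda>y. S0 y - (1 / cnj (coord u N)) *\<^sub>C cinner (S0 y) u *\<^sub>C ket N)"
  have res: "T_res z y - z *\<^sub>C T_op (T_res z y) = y - coord y N *\<^sub>C ket N" for y
  proof (rule ell2_eqI)
    fix n
    consider "n = 0" | "n = N" | "n \<noteq> 0" "n \<noteq> N" by blast
    then show "coord (T_res z y - z *\<^sub>C T_op (T_res z y)) n = coord (y - coord y N *\<^sub>C ket N) n"
    proof cases
      case 3
      have "of_nat n - z \<noteq> 0"
        using 3 by (simp add: z_def)
      then show ?thesis
        using 3 resolvent_entry[of "of_nat n" z "coord y n"]
        by (simp only: coord_diff coord_scaleC coord_T_op coord_T_res coord_ket) simp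
    qed (use N in \<open>auto simp: coord_ket z_def\<close>)
  qed
  have ketN: "ket N - z *\<^sub>C T_op (ket N) = 0"
    using z by (simp add: T_op_ket z_def)
  have S0: "bounded_clinear S0"
    unfolding S0_def by (intro bounded_clinear_intros bounded_clinear_T_res
        bounded_clinear_rank_one)
  have "bounded_clinear (\<lambda>x. x - z *\<^sub>C T_op x)"
    by (intro bounded_clinear_intros bounded_clinear_T_op)
  note L = bounded_clinear_simps(2,3)[OF this]
  have "invertible_op (\<lambda>x. (1 / z) *\<^sub>C x - compress x)"
  proof (rule compress_invertible)
    show "bounded_clinear S"
      unfolding S_def by (intro bounded_clinear_intros S0
        bounded_clinear_compose[OF bounded_clinear_rank_one])
    show "cinner (S y) u = 0" for y
      using uN by (simp add: S_def cinner_diff_left)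
    show "S y - z *\<^sub>C T_op (S y) = z *\<^sub>C y - (z / coord u N * coord y N) *\<^sub>C u" for y
    proof -
      have "S y - z *\<^sub>C T_op (S y) = z *\<^sub>C (T_res z y - z *\<^sub>C T_op (T_res z y)) -
          (z / coord u N * coord y N) *\<^sub>C (T_res z u - z *\<^sub>C T_op (T_res z u)) -
          (1 / cnj (coord u N) * cinner (S0 y) u) *\<^sub>C (ket N - z *\<^sub>C T_op (ket N))"
        unfolding S_def S0_def by (simp only: L scaleC_scaleC cinner_ket)
      also have "\<dots> = z *\<^sub>C y - (z / coord u N * coord y N) *\<^sub>C u"
        unfolding res ketN by (rule ell2_eqI) (use uN in \<open>simp add: algebra_simps\<close>)
      finally show ?thesis .
    qed
    fix x c
    assume x: "cinner x u = 0" "x - z *\<^sub>C T_op x = c *\<^sub>C u"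
    have c: "coord x n - z * coord x n / of_nat n = c * coord u n" for n
      using x(2) by (metis coord_T_op coord_diff coord_scaleC times_divide_eq_right)
    \<comment> \<open>In the \<open>N\<close>-th coordinate the left side of the equation vanishes
      while \<open>coord u N\<close> does not. Once \<open>c = 0\<close>, only the
      \<open>N\<close>-th coordinate of \<open>x\<close> can survive, and orthogonality to
      \<open>u\<close> removes it.\<close>
    have "c = 0"
      using c[of N] uN z by (simp add: z_def)
    have x0: "coord x n = 0" if "n \<noteq> N" for n
    proof (cases "n = 0")
      case False
      have "(of_nat n - z) * coord x n = 0"
        using c[of n] False by (simp add: \<open>c = 0\<close> field_simps)
      then show ?thesis
        using that by (simp add: z_def)
    qed simp
    have "x = coord x N *\<^sub>C ket N"
      by (rule ell2_eqI) (use N x0 in \<open>auto simp: coord_ket\<close>)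
    moreover from this have "cinner x u = coord x N * cnj (coord u N)"
      by (metis cinner_ket_left cinner_scaleC_left)
    then have "coord x N = 0"
      using x(1) uN by simp
    ultimately show "x = 0"
      by simp
  qed (use z in auto)
  then show ?thesis
    by (simp add: z_def)
qed

text \<open>An eigenvector solves \<open>(I - z T) x = c u\<close>, so it is a multiple of
  \<open>T_res z u\<close>. Conversely, \<open>H\<close> says that \<open>T_res z u\<close> lies in
  the complement of \<open>u\<close>, as \<open>compress_solution\<close> requires.\<close>

lemma compress_eigenvectors:
  assumes z: "z \<noteq> 0" "z \<notin> of_nat ` {1..}" and H: "cinner (T_res z u) u = 0"
  shows "compress x = (1 / z) *\<^sub>C x \<longleftrightarrow> (\<exists>c. x = c *\<^sub>C T_res z u)"
proof
  assume "compress x = (1 / z) *\<^sub>C x"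
  then have "(1 / z) *\<^sub>C x - compress x = 0"
    by simp
  then obtain c where "x - z *\<^sub>C T_op x = c *\<^sub>C u"
    using compress_kernel[OF z(1)] by blast
  then have "x = c *\<^sub>C T_res z u"
    using T_res_left[OF z(2), of x] by (simp add: bounded_clinear_simps[OF bounded_clinear_T_res])
  then show "\<exists>c. x = c *\<^sub>C T_res z u" ..
next
  assume "\<exists>c. x = c *\<^sub>C T_res z u"
  then obtain c where x: "x = c *\<^sub>C T_res z u" ..
  \<comment> \<open>The equation is brought to the shape of \<open>compress_solution\<close> with
    \<open>y = 0\<close> and \<open>c = -1\<close>.\<close>
  have "T_res z u - z *\<^sub>C T_op (T_res z u) = z *\<^sub>C 0 - (-1) *\<^sub>C u"
    using T_res_right[OF z(2), of u] by (intro ell2_eqI) simp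
  then have "(1 / z) *\<^sub>C T_res z u - compress (T_res z u) = 0"
    using z H by (intro compress_solution) auto
  then have "compress (T_res z u) = (1 / z) *\<^sub>C T_res z u"
    by simp
  then show "compress x = (1 / z) *\<^sub>C x"
    by (simp add: x bounded_clinear_simps[OF bounded_clinear_compress] mult.commute)
qed

lemma T_res_u_nonzero:
  assumes "z \<notin> of_nat ` {1..}"
  shows "T_res z u \<noteq> 0"
proof
  assume "T_res z u = 0"
  then have "u = 0"
    using T_res_right[OF assms, of u] by (simp add: bounded_clinear_simps[OF bounded_clinear_T_op])
  then show False
    using norm_u by simp
qed

lemma eigenvalue_in_spectrum:
  assumes "is_eigenvalue compress \<mu>"
  shows "\<mu> \<in> spectrum compress"
proof -
  obtain x where x: "x \<noteq> 0" "compress x = \<mu> *\<^sub>C x"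
    using assms by (auto simp: is_eigenvalue_def)
  have "\<not> inj (\<lambda>x. \<mu> *\<^sub>C x - compress x)"
  proof
    assume "inj (\<lambda>x. \<mu> *\<^sub>C x - compress x)"
    from injD[OF this, of x 0] show False
      using x by (simp add: bounded_clinear_simps[OF bounded_clinear_compress])
  qed
  then show ?thesis
    unfolding spectrum_def using invertible_op_imp_inj by blast
qed

text \<open>Zeros of the quadratic form produce an eigenvector; every other \<open>z\<close> has an
  explicit inverse, from the regular case or the pole case. The pole case is where the coordinates
  of \<open>u\<close> must be nonzero.\<close>

lemma spectrum_compress:
  assumes u: "\<And>n. n \<ge> 1 \<Longrightarrow> coord u n \<noteq> 0" and "z \<noteq> 0"
  shows "1 / z \<in> spectrum compress \<longleftrightarrow> z \<notin> of_nat ` {1..} \<and> cinner (T_res z u) u = 0"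
proof
  assume *: "z \<notin> of_nat ` {1..} \<and> cinner (T_res z u) u = 0"
  have "compress (T_res z u) = (1 / z) *\<^sub>C T_res z u"
    using compress_eigenvectors[of z "T_res z u"] * \<open>z \<noteq> 0\<close> by (metis scaleC_one)
  then show "1 / z \<in> spectrum compress"
    using T_res_u_nonzero[of z] * by (intro eigenvalue_in_spectrum) (auto simp: is_eigenvalue_def)
next
  assume "1 / z \<in> spectrum compress"
  then show "z \<notin> of_nat ` {1..} \<and> cinner (T_res z u) u = 0"
    using compress_invertible_regular[of z] compress_invertible_pole u \<open>z \<noteq> 0\<close>
    by (auto simp: spectrum_def)
qed

text \<open>For real \<open>\<mu>\<close> the map \<open>B = compress - \<mu>\<close> is symmetric,
  so \<open>B (B y) = 0\<close> gives \<open>cinner (B y) (B y) = cinner (B (B y)) y = 0\<close>.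
  Powers of \<open>B\<close> can thus be lowered one at a time down to \<open>B\<close>
  itself.\<close>

lemma compress_gen_eigenvector:
  assumes \<mu>: "\<mu> \<in> \<real>" and "((\<lambda>y. compress y - \<mu> *\<^sub>C y) ^^ k) x = 0"
  shows "compress x = \<mu> *\<^sub>C x"
proof -
  define B where "B = (\<lambda>y. compress y - \<mu> *\<^sub>C y)"
  have sym: "cinner (B x) y = cinner x (B y)" for x y
    using \<mu> by (simp add: B_def cinner_diff_left cinner_diff_right cinner_compress Reals_cnj_iff)
  have B0: "B 0 = 0"
    by (simp add: B_def bounded_clinear_simps[OF bounded_clinear_compress])
  have sq: "B y = 0" if "B (B y) = 0" for y
  proof -
    have "cinner (B y) (B y) = 0"
      using sym[of "B y" y] that by simp
    then show ?thesis
      by (simp add: cinner_norm)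
  qed
  have "(B ^^ k) x = 0 \<Longrightarrow> B x = 0" for k
  proof (induction k)
    case (Suc k)
    show ?case
    proof (cases k)
      case (Suc j)
      then have "B (B ((B ^^ j) x)) = 0"
        using Suc.prems by simp
      then have "(B ^^ k) x = 0"
        using sq Suc by simp
      then show ?thesis
        by (rule Suc.IH)
    qed (use Suc.prems in simp)
  qed (simp add: B0)
  then have "B x = 0"
    using assms(2) by (simp add: B_def)
  then show ?thesis
    by (simp add: B_def)
qed

text \<open>Since \<open>z\<close> is real, the generalized eigenspace collapses to the eigenspace,
  which is the line through \<open>T_res z u\<close>.\<close>

lemma compress_simple_eigenvalue:
  assumes z: "z \<in> \<real>" "z \<noteq> 0" "z \<notin> of_nat ` {1..}" and H: "cinner (T_res z u) u = 0"
  shows "is_simple_eigenvalue compress (1 / z)"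
proof -
  interpret vector_space scaleC
    by (rule vector_space_scaleC)
  define v where "v = T_res z u"
  have v: "v \<noteq> 0"
    using T_res_u_nonzero z(3) by (simp add: v_def)
  note eig = compress_eigenvectors[OF z(2,3) H, folded v_def]
  have "gen_eigenspace compress (1 / z) = {x. compress x = (1 / z) *\<^sub>C x}"
  proof (intro equalityI subsetI)
    fix x
    assume "x \<in> {x. compress x = (1 / z) *\<^sub>C x}"
    then have "((\<lambda>y. compress y - (1 / z) *\<^sub>C y) ^^ 1) x = 0"
      by simp
    then show "x \<in> gen_eigenspace compress (1 / z)"
      unfolding gen_eigenspace_def by blast
  next
    fix x
    assume "x \<in> gen_eigenspace compress (1 / z)"
    then show "x \<in> {x. compress x = (1 / z) *\<^sub>C x}"
      unfolding gen_eigenspace_def using compress_gen_eigenvector[of "1 / z"] z(1) by auto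
  qed
  also have "\<dots> = span {v}"
    unfolding span_singleton using eig by auto
  finally have "dim (gen_eigenspace compress (1 / z)) = dim {v}"
    by (simp only: dim_span)
  also have "\<dots> = 1"
    using v by (subst dim_eq_card_independent) auto
  finally have "dim (gen_eigenspace compress (1 / z)) = 1" .
  moreover have "is_eigenvalue compress (1 / z)"
    unfolding is_eigenvalue_def using v eig[of v] by (metis scaleC_one)
  ultimately show ?thesis
    by (simp add: is_simple_eigenvalue_def)
qed

end

section \<open>Series of simple poles at the positive integers\<close>

text \<open>Indices are shifted: the weight \<open>a k\<close> belongs to the pole at
  \<open>k + 1\<close>. The factors are the diagonal entries of \<open>T_res z\<close>.\<close>

definition pole_sum :: "(nat \<Rightarrow> real) \<Rightarrow> complex \<Rightarrow> complex"
  where "pole_sum a z = (\<Sum>k. of_real (a k) * (of_nat (Suc k) / (of_nat (Suc k) - z)))"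

lemma of_nat_ge_1_image: "of_nat ` {1..} = range (\<lambda>k. of_nat (Suc k))"
proof -
  have "{1::nat..} = range Suc"
    by (auto simp: image_iff Suc_le_eq gr0_conv_Suc)
  then show ?thesis
    by (simp only: image_image)
qed

lemma of_real_notin_of_nat:
  "(\<And>n. n \<ge> 1 \<Longrightarrow> x \<noteq> real n) \<Longrightarrow> complex_of_real x \<notin> of_nat ` {1..}"
proof
  assume *: "\<And>n. n \<ge> 1 \<Longrightarrow> x \<noteq> real n"
  assume "complex_of_real x \<in> of_nat ` {1..}"
  then obtain n where "n \<ge> 1" "complex_of_real x = of_real (real n)"
    by auto
  then show False
    using * by (simp only: of_real_eq_iff)
qed

text \<open>The bound is uniform in \<open>k\<close> because
  \<open>n / (n - z) = 1 + z / (n - z)\<close>. If the disc of radius \<open>e\<close> is free of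
  poles, points of the disc of radius \<open>e / 2\<close> keep distance at least
  \<open>e / 2\<close> from all of them.\<close>

lemma pole_factor_locally_bounded:
  fixes z0 :: complex
  assumes "z0 \<notin> of_nat ` {1..}"
  obtains r K where "r > 0" "\<And>z. z \<in> cball z0 r \<Longrightarrow> z \<notin> of_nat ` {1..}"
    "\<And>z k. z \<in> cball z0 r \<Longrightarrow> cmod (of_nat (Suc k) / (of_nat (Suc k) - z)) \<le> K"
proof -
  have "open (- (of_nat ` {1..}) :: complex set)"
    using closed_of_nat_image by blast
  then obtain e where e: "e > 0" "cball z0 e \<subseteq> - of_nat ` {1..}"
    using assms open_contains_cball[of "- (of_nat ` {1..}) :: complex set"] by blast
  show thesis
  proof (rule that[of "e / 2" "1 + (cmod z0 + e) / (e / 2)"])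
    show "e / 2 > 0"
      using e by simp
    fix z :: complex
    assume z: "z \<in> cball z0 (e / 2)"
    moreover have "cball z0 (e / 2) \<subseteq> cball z0 e"
      using e by (intro subset_cball) simp
    ultimately show "z \<notin> of_nat ` {1..}"
      using e by blast
    fix k
    have "of_nat (Suc k) \<notin> cball z0 e"
      using e of_nat_ge_1_image by blast
    then have "dist z0 (of_nat (Suc k)) > e"
      by simp
    then have dist: "cmod (of_nat (Suc k) - z) \<ge> e / 2"
      using z dist_triangle[of z0 "of_nat (Suc k)" z] by (simp add: dist_norm norm_minus_commute)
    have z_le: "cmod z \<le> cmod z0 + e"
      using z e norm_triangle_ineq2[of z z0] by (simp add: dist_norm norm_minus_commute)
    have "of_nat (Suc k) - z \<noteq> 0"
      using dist e by auto
    then have "of_nat (Suc k) / (of_nat (Suc k) - z) = 1 + z / (of_nat (Suc k) - z)"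
      by (simp add: divide_simps)
    also have "cmod \<dots> \<le> 1 + cmod z / cmod (of_nat (Suc k) - z)"
      by (metis norm_divide norm_one norm_triangle_ineq)
    also have "\<dots> \<le> 1 + (cmod z0 + e) / (e / 2)"
      using z_le dist e by (intro add_left_mono frac_le) auto
    finally show "cmod (of_nat (Suc k) / (of_nat (Suc k) - z)) \<le> 1 + (cmod z0 + e) / (e / 2)" .
  qed
qed

context
  fixes a :: "nat \<Rightarrow> real"
  assumes nonneg: "\<And>k. a k \<ge> 0" and summ: "summable a"
begin

lemma pole_sum_sums:
  assumes "z \<notin> of_nat ` {1..}"
  shows "(\<lambda>k. of_real (a k) * (of_nat (Suc k) / (of_nat (Suc k) - z))) sums pole_sum a z"
proof -
  obtain K where K: "\<And>k. cmod (of_nat (Suc k) / (of_nat (Suc k) - z)) \<le> K"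
    using pole_factor_locally_bounded[OF assms] by (metis centre_in_cball less_imp_le)
  have "summable (\<lambda>k. of_real (a k) * (of_nat (Suc k) / (of_nat (Suc k) - z)))"
  proof (rule summable_comparison_test'[where N = 0])
    show "summable (\<lambda>k. a k * K)"
      by (intro summable_mult2 summ)
    show "norm (of_real (a k) * (of_nat (Suc k) / (of_nat (Suc k) - z))) \<le> a k * K" for k
      unfolding norm_mult using nonneg[of k] by (intro mult_mono K) auto
  qed
  then show ?thesis
    by (simp only: pole_sum_def summable_sums)
qed

lemma pole_sum_holomorphic: "pole_sum a holomorphic_on - of_nat ` {1..}"
proof (rule holomorphic_uniform_sequence)
  show "open (- (of_nat ` {1..}) :: complex set)"
    using closed_of_nat_image by blast
  show "(\<lambda>z. \<Sum>k<n. of_real (a k) * (of_nat (Suc k) / (of_nat (Suc k) - z))) holomorphic_on - of_nat ` {1..}" for n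
    unfolding of_nat_ge_1_image by (intro holomorphic_intros) auto
  fix z0 :: complex
  assume "z0 \<in> - of_nat ` {1..}"
  then have "z0 \<notin> of_nat ` {1..}"
    by blast
  from pole_factor_locally_bounded[OF this] obtain r K where rK: "r > 0"
    "\<And>z. z \<in> cball z0 r \<Longrightarrow> z \<notin> of_nat ` {1..}"
    "\<And>z k. z \<in> cball z0 r \<Longrightarrow> cmod (of_nat (Suc k) / (of_nat (Suc k) - z)) \<le> K"
    by metis
  have "uniform_limit (cball z0 r)
      (\<lambda>n z. \<Sum>k<n. of_real (a k) * (of_nat (Suc k) / (of_nat (Suc k) - z))) (pole_sum a) sequentially"
    unfolding pole_sum_def[abs_def]
  proof (rule Weierstrass_m_test)
    show "summable (\<lambda>k. a k * K)"
      by (intro summable_mult2 summ)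
    show "norm (of_real (a k) * (of_nat (Suc k) / (of_nat (Suc k) - z))) \<le> a k * K" if "z \<in> cball z0 r" for z k
      unfolding norm_mult using nonneg[of k] by (intro mult_mono rK that) auto
  qed
  then show "\<exists>d>0. cball z0 d \<subseteq> - of_nat ` {1..} \<and> uniform_limit (cball z0 d)
      (\<lambda>n z. \<Sum>k<n. of_real (a k) * (of_nat (Suc k) / (of_nat (Suc k) - z))) (pole_sum a) sequentially"
    using rK by blast
qed

end

section \<open>Location of the zeros for strictly positive weights\<close>

locale positive_weights =
  fixes a :: "nat \<Rightarrow> real"
  assumes pos: "\<And>k. a k > 0" and summ: "summable a"
begin

definition real_pole_sum :: "real \<Rightarrow> real"
  where "real_pole_sum x = (\<Sum>k. a k * (real (Suc k) / (real (Suc k) - x)))"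

lemma pole_sums:
  "z \<notin> of_nat ` {1..} \<Longrightarrow> (\<lambda>k. of_real (a k) * (of_nat (Suc k) / (of_nat (Suc k) - z))) sums pole_sum a z"
  by (intro pole_sum_sums summ less_imp_le pos)

lemma real_pole_sum_sums:
  assumes "complex_of_real x \<notin> of_nat ` {1..}"
  shows "(\<lambda>k. a k * (real (Suc k) / (real (Suc k) - x))) sums real_pole_sum x"
    and "pole_sum a (of_real x) = of_real (real_pole_sum x)"
proof -
  have eq: "of_real (a k) * (of_nat (Suc k) / (of_nat (Suc k) - complex_of_real x)) =
      of_real (a k * (real (Suc k) / (real (Suc k) - x)))" for k
    by simp
  have sums: "(\<lambda>k. complex_of_real (a k * (real (Suc k) / (real (Suc k) - x)))) sums pole_sum a (of_real x)"
    using pole_sums[OF assms] by (simp only: eq)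
  then have Re: "(\<lambda>k. a k * (real (Suc k) / (real (Suc k) - x))) sums Re (pole_sum a (of_real x))"
    using sums_Re by fastforce
  then show *: "(\<lambda>k. a k * (real (Suc k) / (real (Suc k) - x))) sums real_pole_sum x"
    by (simp only: real_pole_sum_def sums_iff)
  show "pole_sum a (of_real x) = of_real (real_pole_sum x)"
    using sums_unique2[OF sums sums_of_real[OF *]] .
qed

text \<open>The Nevanlinna property: every term has an imaginary part of the same sign as
  \<open>Im z\<close>, so no cancellation is possible.\<close>

lemma pole_sum_nonreal:
  assumes "Im z \<noteq> 0"
  shows "pole_sum a z \<noteq> 0"
proof
  assume 0: "pole_sum a z = 0"
  have z: "z \<notin> of_nat ` {1..}"
    using assms by auto
  \<comment> \<open>The factor \<open>Im z\<close> treats the upper and the lower half-plane at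
    once.\<close>
  have "(\<lambda>k. Im z * Im (of_real (a k) * (of_nat (Suc k) / (of_nat (Suc k) - z)))) sums (Im z * Im 0)"
    using sums_mult[OF sums_Im[OF pole_sums[OF z]], of "Im z"] by (simp only: 0)
  moreover have "Im z * Im (of_real (a k) * (of_nat (Suc k) / (of_nat (Suc k) - z))) > 0" for k
  proof -
    have "Im z * Im (of_real (a k) * (of_nat (Suc k) / (of_nat (Suc k) - z))) =
        a k * real (Suc k) * (Im z)\<^sup>2 / ((real (Suc k) - Re z)\<^sup>2 + (Im z)\<^sup>2)"
      by (simp add: Im_divide power2_eq_square del: of_nat_Suc)
    also have "\<dots> > 0"
      using assms pos[of k] by (intro divide_pos_pos mult_pos_pos) (auto intro: add_nonneg_pos)
    finally show ?thesis .
  qed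
  ultimately show False
    using suminf_pos[of "\<lambda>k. Im z * Im (of_real (a k) * (of_nat (Suc k) / (of_nat (Suc k) - z)))"]
    by (simp only: sums_iff) auto
qed

lemma real_pole_sum_pos:
  assumes "x < 1"
  shows "real_pole_sum x > 0"
proof -
  have "(\<lambda>k. a k * (real (Suc k) / (real (Suc k) - x))) sums real_pole_sum x"
    by (intro real_pole_sum_sums of_real_notin_of_nat) (use assms in auto)
  moreover have "a k * (real (Suc k) / (real (Suc k) - x)) > 0" for k
    using assms by (intro mult_pos_pos divide_pos_pos pos) auto
  ultimately show ?thesis
    using suminf_pos[of "\<lambda>k. a k * (real (Suc k) / (real (Suc k) - x))"] by (simp only: sums_iff)
qed

context
  fixes n :: nat
  assumes n: "n \<ge> 1"
begin

lemma gap_notin: "real n < x \<Longrightarrow> x < real n + 1 \<Longrightarrow> complex_of_real x \<notin> of_nat ` {1..}"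
  by (rule of_real_notin_of_nat) auto

lemmas gap_sums = real_pole_sum_sums(1)[OF gap_notin]

text \<open>No pole separates \<open>x\<close> from \<open>y\<close>, so for each pole
  \<open>m\<close> the product \<open>(m - x) * (m - y)\<close> is positive and the corresponding
  term increases.\<close>

lemma real_pole_sum_strict_mono:
  assumes "real n < x" "x < y" "y < real n + 1"
  shows "real_pole_sum x < real_pole_sum y"
proof -
  define t where "t x k = a k * (real (Suc k) / (real (Suc k) - x))" for x k
  have "(\<lambda>k. t y k - t x k) sums (real_pole_sum y - real_pole_sum x)"
    unfolding t_def by (intro sums_diff gap_sums) (use assms in auto)
  moreover have "t y k - t x k > 0" for k
  proof -
    have "(real (Suc k) - x) * (real (Suc k) - y) > 0"
    proof (cases "k < n")
      case True
      then have "real (Suc k) \<le> real n"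
        by simp
      then show ?thesis
        using assms by (intro mult_neg_neg) linarith+
    next
      case False
      then have "real (Suc k) \<ge> real n + 1"
        by simp
      then show ?thesis
        using assms by (intro mult_pos_pos) linarith+
    qed
    moreover from this have "t y k - t x k =
        a k * real (Suc k) * (y - x) / ((real (Suc k) - x) * (real (Suc k) - y))"
      unfolding t_def by (auto simp: divide_simps) (auto simp: algebra_simps)
    ultimately show ?thesis
      using assms pos[of k] by (simp add: divide_pos_pos mult_pos_pos)
  qed
  ultimately show ?thesis
    using suminf_pos[of "\<lambda>k. t y k - t x k"] by (simp add: sums_iff)
qed

text \<open>Forces the sum to \<open>-\<infinity>\<close> at the left end. The term of the pole
  \<open>n\<close>, with weight \<open>a (n - 1)\<close>, is kept exactly; earlier poles have
  factors at most 0, and later ones at most \<open>2 * (n + 1)\<close>, being at least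
  \<open>1 / 2\<close> away.\<close>

lemma real_pole_sum_upper:
  assumes "real n < x" "x \<le> real n + 1 / 2"
  shows "real_pole_sum x \<le> 2 * (real n + 1) * suminf a - a (n - 1) * real n / (x - real n)"
proof -
  define t where "t k = a k * (real (Suc k) / (real (Suc k) - x))" for k
  have t: "t sums real_pole_sum x"
    unfolding t_def by (intro gap_sums) (use assms in auto)
  have bound: "(\<lambda>k. 2 * (real n + 1) * a k + (if k = n - 1 then t k else 0)) sums
      (2 * (real n + 1) * suminf a + t (n - 1))"
    by (intro sums_add sums_mult sums_single summable_sums summ)
  have le: "t k \<le> 2 * (real n + 1) * a k + (if k = n - 1 then t k else 0)" for k
  proof (cases "k = n - 1")
    case False
    have "real (Suc k) / (real (Suc k) - x) \<le> 2 * (real n + 1)"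
    proof (cases "k < n")
      case True
      then have "real (Suc k) - x \<le> 0"
        using assms by (simp add: nat_less_real_le)
      then have "real (Suc k) / (real (Suc k) - x) \<le> 0"
        by (intro divide_nonneg_nonpos) auto
      then show ?thesis
        by (rule order_trans) simp
    next
      case False
      then have k: "real (Suc k) \<ge> real n + 1"
        by simp
      have "real (Suc k) - x \<ge> real (Suc k) - (real n + 1 / 2)"
        using assms by simp
      then have "2 * (real n + 1) * (real (Suc k) - x) \<ge> 2 * (real n + 1) * (real (Suc k) - (real n + 1 / 2))"
        by (intro mult_left_mono) auto
      \<comment> \<open>The slack of the bound is linear in the pole and vanishes at the nearest
        one, \<open>n + 1\<close>.\<close>
      moreover have "2 * (real n + 1) * (real (Suc k) - (real n + 1 / 2)) - real (Suc k) =
          (2 * real n + 1) * (real (Suc k) - (real n + 1))"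
        by (simp add: algebra_simps)
      moreover have "(2 * real n + 1) * (real (Suc k) - (real n + 1)) \<ge> 0"
        using k by (intro mult_nonneg_nonneg) auto
      ultimately have "real (Suc k) \<le> 2 * (real n + 1) * (real (Suc k) - x)"
        by linarith
      moreover have "real (Suc k) - x > 0"
        using k assms by linarith
      ultimately show ?thesis
        by (simp only: pos_divide_le_eq)
    qed
    then have "t k \<le> a k * (2 * (real n + 1))"
      unfolding t_def using pos[of k] by (intro mult_left_mono) auto
    then show ?thesis
      using False by (simp add: mult.commute)
  qed (use pos[of k] in simp)
  have "real_pole_sum x \<le> 2 * (real n + 1) * suminf a + t (n - 1)"
    by (rule sums_le[OF le t bound])
  also have "t (n - 1) = a (n - 1) * (real n / - (x - real n))"
    using n by (simp add: t_def)
  also have "\<dots> = - (a (n - 1) * real n / (x - real n))"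
    by (simp only: divide_minus_right mult_minus_right times_divide_eq_right)
  finally show ?thesis
    by simp
qed

text \<open>The mirror image at the right end, where the pole \<open>n + 1\<close> with weight
  \<open>a n\<close> dominates. Poles up to \<open>n\<close> have distance at least
  \<open>1 / 2\<close>, so their factors are at least \<open>-2 * n\<close>.\<close>

lemma real_pole_sum_lower:
  assumes "real n + 1 / 2 \<le> x" "x < real n + 1"
  shows "real_pole_sum x \<ge> a n * (real n + 1) / (real n + 1 - x) - 2 * real n * suminf a"
proof -
  define t where "t k = a k * (real (Suc k) / (real (Suc k) - x))" for k
  have t: "t sums real_pole_sum x"
    unfolding t_def by (intro gap_sums) (use assms in auto)
  have *: "(\<lambda>k. (if k = n then t k else 0) - 2 * real n * a k) sums (t n - 2 * real n * suminf a)"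
    by (intro sums_diff sums_mult sums_single summable_sums summ)
  have "(if k = n then t k else 0) - 2 * real n * a k \<le> t k" for k
  proof (cases "k = n")
    case False
    have "- (2 * real n) \<le> real (Suc k) / (real (Suc k) - x)"
    proof (cases "k < n")
      case True
      then have k: "real (Suc k) \<le> real n"
        by simp
      have "2 * real n * (x - real (Suc k)) \<ge> 2 * real n * (1 / 2)"
        using k assms by (intro mult_left_mono) auto
      then have "real (Suc k) \<le> 2 * real n * (x - real (Suc k))"
        using k by linarith
      then have "real (Suc k) \<le> - (2 * real n) * (real (Suc k) - x)"
        by (simp add: algebra_simps del: of_nat_Suc)
      moreover have "real (Suc k) - x < 0"
        using k assms by linarith
      ultimately show ?thesis
        by (simp only: neg_le_divide_eq)
    next
      case False
      then have "real (Suc k) - x \<ge> 0"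
        using assms by simp
      then have "real (Suc k) / (real (Suc k) - x) \<ge> 0"
        by (intro divide_nonneg_nonneg) auto
      then show ?thesis
        by (rule order_trans[rotated]) simp
    qed
    then have "a k * - (2 * real n) \<le> t k"
      unfolding t_def using pos[of k] by (intro mult_left_mono) auto
    then show ?thesis
      using False by (simp add: mult_ac)
  qed (use pos[of k] in simp)
  then have "t n - 2 * real n * suminf a \<le> real_pole_sum x"
    using * t by (rule sums_le)
  then show ?thesis
    by (simp add: t_def add.commute)
qed

lemma continuous_on_real_pole_sum: "continuous_on {real n<..<real n + 1} real_pole_sum"
proof -
  have "continuous_on (- of_nat ` {1..}) (pole_sum a)"
    by (intro holomorphic_on_imp_continuous_on pole_sum_holomorphic summ less_imp_le pos)
  then have "continuous_on {real n<..<real n + 1} (\<lambda>x. pole_sum a (of_real x))"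
    by (rule continuous_on_compose2[OF _ continuous_on_of_real_id])
      (metis ComplI gap_notin greaterThanLessThan_iff image_subsetI)
  then have "continuous_on {real n<..<real n + 1} (\<lambda>x. Re (pole_sum a (of_real x)))"
    by (intro continuous_intros)
  then show ?thesis
    by (rule continuous_on_eq) (use real_pole_sum_sums(2)[OF gap_notin] in auto)
qed

text \<open>The two estimates give opposite signs near the ends of the gap, the intermediate value
  theorem gives a zero, and strict monotonicity makes it unique.\<close>

lemma real_pole_sum_zero_ex1: "\<exists>!x. real n < x \<and> x < real n + 1 \<and> real_pole_sum x = 0"
proof -
  define A where "A = suminf a"
  have A: "A > 0"
    unfolding A_def by (intro suminf_pos summ pos)
  have left: "\<exists>x. real n < x \<and> x \<le> real n + 1 / 2 \<and> real_pole_sum x \<le> 0"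
  proof -
    define c where "c = a (n - 1) * real n"
    define M where "M = 2 * (real n + 1) * A"
    have "c > 0" "M > 0"
      using n pos A by (auto simp: c_def M_def)
    \<comment> \<open>At distance \<open>d \<le> c / M\<close> the polar term \<open>c / d\<close>
      outweighs the remainder \<open>M\<close>; the cap \<open>1 / 2\<close> keeps the point in the
      range of the estimate.\<close>
    define d where "d = min (1 / 2) (c / M)"
    have d: "0 < d" "d \<le> 1 / 2" "d \<le> c / M"
      unfolding d_def using \<open>c > 0\<close> \<open>M > 0\<close> by (simp_all only: min.cobounded1 min.cobounded2) simp
    have "M \<le> c / d"
      using d \<open>M > 0\<close> by (simp add: field_simps)
    moreover have "real_pole_sum (real n + d) \<le> M - c / d"
      using real_pole_sum_upper[of "real n + d"] d by (simp add: c_def M_def A_def)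
    ultimately show ?thesis
      using d by (intro exI[of _ "real n + d"]) auto
  qed
  have right: "\<exists>x. real n + 1 / 2 \<le> x \<and> x < real n + 1 \<and> real_pole_sum x \<ge> 0"
  proof -
    define c where "c = a n * (real n + 1)"
    define M where "M = 2 * real n * A"
    have "c > 0" "M > 0"
      using n pos A by (auto simp: c_def M_def)
    define d where "d = min (1 / 2) (c / M)"
    have d: "0 < d" "d \<le> 1 / 2" "d \<le> c / M"
      unfolding d_def using \<open>c > 0\<close> \<open>M > 0\<close> by (simp_all only: min.cobounded1 min.cobounded2) simp
    have "M \<le> c / d"
      using d \<open>M > 0\<close> by (simp add: field_simps)
    moreover have "real_pole_sum (real n + 1 - d) \<ge> c / d - M"
      using real_pole_sum_lower[of "real n + 1 - d"] d by (simp add: c_def M_def A_def)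
    ultimately show ?thesis
      using d by (intro exI[of _ "real n + 1 - d"]) auto
  qed
  obtain l r where lr: "real n < l" "l \<le> real n + 1 / 2" "real_pole_sum l \<le> 0"
    "real n + 1 / 2 \<le> r" "r < real n + 1" "real_pole_sum r \<ge> 0"
    using left right by blast
  have "\<exists>x. l \<le> x \<and> x \<le> r \<and> real_pole_sum x = 0"
    by (rule IVT') (use lr in \<open>auto intro: continuous_on_subset[OF continuous_on_real_pole_sum]\<close>)
  then obtain x where "l \<le> x" "x \<le> r" "real_pole_sum x = 0"
    by blast
  then have x: "real n < x" "x < real n + 1" "real_pole_sum x = 0"
    using lr by auto
  have "y = x" if "real n < y" "y < real n + 1" "real_pole_sum y = 0" for y
    using real_pole_sum_strict_mono[of x y] real_pole_sum_strict_mono[of y x] that x by (metis linorder_neqE less_irrefl)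
  then show ?thesis
    using x by blast
qed

end

lemma pole_sum_zero_iff:
  "z \<notin> of_nat ` {1..} \<and> pole_sum a z = 0 \<longleftrightarrow>
    (\<exists>n\<ge>1. \<exists>x. real n < x \<and> x < real n + 1 \<and> real_pole_sum x = 0 \<and> z = of_real x)"
proof
  assume *: "z \<notin> of_nat ` {1..} \<and> pole_sum a z = 0"
  define x where "x = Re z"
  have "Im z = 0"
    using pole_sum_nonreal * by blast
  then have z: "z = of_real x"
    by (simp add: x_def complex_eq_iff)
  have real_pole_sum: "real_pole_sum x = 0"
    using real_pole_sum_sums(2)[of x] * z by simp
  then have "x \<ge> 1"
    using real_pole_sum_pos[of x] by force
  \<comment> \<open>The floor selects the gap; its left end is excluded because \<open>z\<close> is
    not a pole.\<close>
  define n where "n = nat \<lfloor>x\<rfloor>"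
  have n: "n \<ge> 1" "real n \<le> x" "x < real n + 1"
    using \<open>x \<ge> 1\<close> by (auto simp: n_def le_nat_iff)
  moreover have "x \<noteq> real n"
    using * z n by auto
  ultimately show "\<exists>n\<ge>1. \<exists>x. real n < x \<and> x < real n + 1 \<and> real_pole_sum x = 0 \<and> z = of_real x"
    using real_pole_sum z by (intro exI[of _ n] exI[of _ x] conjI) auto
next
  assume "\<exists>n\<ge>1. \<exists>x. real n < x \<and> x < real n + 1 \<and> real_pole_sum x = 0 \<and> z = of_real x"
  then show "z \<notin> of_nat ` {1..} \<and> pole_sum a z = 0"
    using gap_notin real_pole_sum_sums(2)[OF gap_notin] by (metis of_real_0)
qed

end

section \<open>The partial fraction expansion of the Gregory transform\<close>

text \<open>This is \<open>\<bar>x choose (k + 1)\<bar>\<close> for \<open>0 < x < 1\<close>.\<close>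

definition binom_weight :: "real \<Rightarrow> nat \<Rightarrow> real"
  where "binom_weight x k = x * pochhammer (1 - x) k / fact (Suc k)"

lemma binom_weight_gbinomial: "x gchoose Suc k = (-1) ^ k * binom_weight x k"
  unfolding binom_weight_def gbinomial_pochhammer pochhammer_rec[of "- x"] by simp

lemma binom_weight_pos: "0 < x \<Longrightarrow> x < 1 \<Longrightarrow> binom_weight x k > 0"
  unfolding binom_weight_def by (intro divide_pos_pos mult_pos_pos pochhammer_pos) auto

lemma binom_weight_nonneg: "0 < x \<Longrightarrow> x < 1 \<Longrightarrow> binom_weight x k \<ge> 0"
  by (intro less_imp_le binom_weight_pos)

lemma continuous_on_binom_weight: "continuous_on A (\<lambda>x. binom_weight x k)"
  unfolding binom_weight_def pochhammer_prod by (intro continuous_intros) auto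

text \<open>The binomial series of \<open>(1 - t) powr (x - 1)\<close> is integrated termwise
  against \<open>t powr (w - 1)\<close>. For \<open>0 < x < 1\<close> its coefficients in
  \<open>t\<close> are nonnegative, so the full integrand dominates the partial sums. With
  \<open>w = 1 - z\<close> the denominators become \<open>k + 1 - z\<close>.\<close>

lemma binom_weight_Beta_sums:
  fixes x w :: real
  assumes x: "0 < x" "x < 1" and w: "w > 0"
  shows "(\<lambda>k. binom_weight x k * (real (Suc k) / (real k + w))) sums (x * Beta x w)"
proof -
  define b where "b k = pochhammer (1 - x) k / fact k" for k
  have b_nonneg: "b k \<ge> 0" for k
    using x by (auto simp: b_def intro!: pochhammer_nonneg divide_nonneg_pos)
  have binom_weight: "binom_weight x k * real (Suc k) = x * b k" for k
    by (simp add: binom_weight_def b_def del: of_nat_Suc)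
  define g where "g t = t powr (w - 1) * (1 - t) powr (x - 1)" for t
  define f where "f n t = (\<Sum>k<n. b k * t powr (w - 1 + real k))" for n t
  have g: "(g has_integral Beta w x) {0<..<1}"
    using has_integral_Beta_real[OF w x(1)] by (simp add: g_def[abs_def] has_integral_Icc_iff_Ioo)
  have f: "(f n has_integral (\<Sum>k<n. b k * (1 / (real k + w)))) {0<..<1}" for n
  proof -
    have "((\<lambda>t. t powr (w - 1 + real k)) has_integral 1 / (real k + w)) {0<..<1}" for k
      using has_integral_powr_from_0[of "w - 1 + real k" 1] w
      by (simp add: has_integral_Icc_iff_Ioo add.commute)
    then show ?thesis
      unfolding f_def[abs_def] by (intro has_integral_sum has_integral_mult_right) auto
  qed
  have sums: "(\<lambda>k. b k * t powr (w - 1 + real k)) sums g t" if "t \<in> {0<..<1}" for t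
  proof -
    have "(\<lambda>k. (x - 1 gchoose k) * (- t) ^ k) sums (1 + - t) powr (x - 1)"
      using that by (intro gen_binomial_real) auto
    moreover have "(x - 1 gchoose k) * (- t) ^ k = b k * t ^ k" for k
    proof -
      have "x - 1 gchoose k = (-1) ^ k * b k"
        by (simp add: b_def gbinomial_pochhammer)
      moreover have "(- t) ^ k = (-1) ^ k * t ^ k"
        by (rule power_minus)
      moreover have "(-1) ^ k * (-1) ^ k = (1 :: real)"
        by (simp flip: power_mult_distrib)
      ultimately show ?thesis
        by (metis (no_types, opaque_lifting) mult.assoc mult.commute mult.left_neutral)
    qed
    ultimately have "(\<lambda>k. t powr (w - 1) * (b k * t ^ k)) sums (t powr (w - 1) * (1 - t) powr (x - 1))"
      by (intro sums_mult) simp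
    then show ?thesis
      using that by (simp add: g_def powr_add powr_realpow mult_ac)
  qed
  have "(\<lambda>n. integral {0<..<1} (f n)) \<longlonglongrightarrow> integral {0<..<1} g"
  proof (rule dominated_convergence(2))
    show "f n integrable_on {0<..<1}" for n
      using f by blast
    show "g integrable_on {0<..<1}"
      using g by blast
    show "(\<lambda>n. f n t) \<longlonglongrightarrow> g t" if "t \<in> {0<..<1}" for t
      using sums[OF that] by (simp add: sums_def f_def)
    show "norm (f n t) \<le> g t" if "t \<in> {0<..<1}" for n t
    proof -
      have "f n t \<le> g t"
        unfolding f_def sums_unique[OF sums[OF that]]
        by (intro sum_le_suminf sums_summable[OF sums[OF that]]) (auto intro!: b_nonneg mult_nonneg_nonneg)
      moreover have "f n t \<ge> 0"
        unfolding f_def by (intro sum_nonneg mult_nonneg_nonneg b_nonneg) auto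
      ultimately show ?thesis by simp
    qed
  qed
  then have "(\<lambda>k. b k * (1 / (real k + w))) sums Beta w x"
    by (simp only: integral_unique[OF f] integral_unique[OF g] sums_def)
  then have "(\<lambda>k. x * (b k * (1 / (real k + w)))) sums (x * Beta x w)"
    by (subst Beta_commute) (rule sums_mult)
  moreover have "x * (b k * (1 / (real k + w))) = binom_weight x k * (real (Suc k) / (real k + w))" for k
    using binom_weight[of k] by (simp only: times_divide_eq_right mult_1_right)
  ultimately show ?thesis
    by (simp only:)
qed

text \<open>The case \<open>w = 1\<close>, in which all pole factors equal 1 and
  \<open>x * Beta x 1 = 1\<close>.\<close>

lemma binom_weight_sums_1:
  fixes x :: real
  assumes "0 < x" "x < 1"
  shows "binom_weight x sums 1"
proof -
  have "x * Beta x 1 = 1"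
  proof -
    have "x \<notin> \<int>\<^sub>\<le>\<^sub>0"
      using assms by (auto elim!: nonpos_Ints_cases)
    then show ?thesis
      using Gamma_plus1[of x] assms by (simp add: Beta_def Gamma_eq_zero_iff)
  qed
  moreover have "(\<lambda>k. binom_weight x k * (real (Suc k) / (real k + 1))) sums (x * Beta x 1)"
    by (rule binom_weight_Beta_sums) (use assms in auto)
  ultimately show ?thesis
    by (simp add: add.commute)
qed

text \<open>Both sides are holomorphic off the positive integers, a connected domain, and agree on
  the real interval \<open>(0, 1)\<close>, which accumulates at the interior point 0.\<close>

lemma pole_sum_binom_weight:
  fixes x :: real
  assumes x: "0 < x" "x < 1" and z: "z \<notin> of_nat ` {1..}"
  shows "pole_sum (binom_weight x) z = Gamma (1 - z) * (Gamma (of_real x + 1) * rGamma (of_real x - z + 1))"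
proof -
  define F :: "complex \<Rightarrow> complex"
    where "F z = Gamma (1 - z) * (Gamma (of_real x + 1) * rGamma (of_real x - z + 1))" for z
  let ?S = "- of_nat ` {1..} :: complex set"
  have binom_weight: "\<And>k. binom_weight x k \<ge> 0" "summable (binom_weight x)"
    using x binom_weight_sums_1[OF x] by (auto intro: binom_weight_nonneg simp: sums_iff)
  have "pole_sum (binom_weight x) z - F z = 0"
  proof (rule analytic_continuation[where f = "\<lambda>z. pole_sum (binom_weight x) z - F z" and S = ?S and \<xi> = 0
        and U = "of_real ` {0<..<1}"])
    have "1 - z \<notin> \<int>\<^sub>\<le>\<^sub>0" if "z \<in> ?S" for z
    proof
      assume "1 - z \<in> \<int>\<^sub>\<le>\<^sub>0"
      then obtain n where "1 - z = - of_nat n"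
        by (rule nonpos_Ints_cases')
      then have "z = of_nat (Suc n)"
        by (simp add: algebra_simps)
      then show False
        using that of_nat_ge_1_image by blast
    qed
    then show "(\<lambda>z. pole_sum (binom_weight x) z - F z) holomorphic_on ?S"
      unfolding F_def by (intro holomorphic_intros pole_sum_holomorphic binom_weight) auto
    show "open ?S"
      using closed_of_nat_image by blast
    have "countable (of_nat ` {1..} :: complex set)"
      by auto
    then have "connected (UNIV - of_nat ` {1..} :: complex set)"
      by (intro connected_open_diff_countable) auto
    then show "connected ?S"
      by (simp add: Compl_eq_Diff_UNIV)
    show "of_real ` {0<..<1} \<subseteq> ?S"
    proof (intro subsetI ComplI)
      fix y :: complex
      assume "y \<in> of_real ` {0<..<1}" "y \<in> of_nat ` {1..}"
      then obtain t n where "t \<in> {0<..<1}" "n \<ge> 1" "complex_of_real t = of_real (real n)"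
        by auto
      then show False
        by (simp only: of_real_eq_iff) auto
    qed
    show "0 \<in> ?S"
      by auto
    show "0 islimpt (of_real ` {0<..<1} :: complex set)"
      unfolding islimpt_approachable
    proof (intro allI impI)
      fix e :: real
      assume "e > 0"
      then show "\<exists>x'\<in>complex_of_real ` {0<..<1}. x' \<noteq> 0 \<and> dist x' 0 < e"
        by (intro bexI[of _ "of_real (min (1 / 2) (e / 2))"]) auto
    qed
    fix y
    assume "y \<in> complex_of_real ` {0<..<1}"
    then obtain t where t: "y = of_real t" "0 < t" "t < 1"
      by auto
    have "(\<lambda>k. complex_of_real (binom_weight x k * (real (Suc k) / (real k + (1 - t))))) sums of_real (x * Beta x (1 - t))"
      by (intro sums_of_real binom_weight_Beta_sums x) (use t in auto)
    moreover have "complex_of_real (binom_weight x k * (real (Suc k) / (real k + (1 - t)))) =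
        of_real (binom_weight x k) * (of_nat (Suc k) / (of_nat (Suc k) - y))" for k
      by (simp add: t algebra_simps)
    ultimately have "pole_sum (binom_weight x) y = of_real (x * Beta x (1 - t))"
      by (simp only: pole_sum_def sums_iff)
    \<comment> \<open>The factor \<open>x\<close> is absorbed by
      \<open>x * Gamma x = Gamma (x + 1)\<close>.\<close>
    also have "x * Beta x (1 - t) = Gamma (1 - t) * (Gamma (x + 1) * rGamma (x - t + 1))"
    proof -
      have "x \<notin> \<int>\<^sub>\<le>\<^sub>0"
        using x by (auto elim!: nonpos_Ints_cases)
      then show ?thesis
        using Gamma_plus1[of x] by (simp add: Beta_altdef algebra_simps)
    qed
    also have "complex_of_real \<dots> = F y"
    proof -
      have "1 - y = of_real (1 - t)" "of_real x + 1 = complex_of_real (x + 1)"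
        "of_real x - y + 1 = of_real (x - t + 1)"
        by (simp_all add: t)
      then show ?thesis
        by (simp only: F_def Gamma_complex_of_real rGamma_complex_of_real of_real_mult)
    qed
    finally show "pole_sum (binom_weight x) y - F y = 0"
      by simp
  qed (use z in auto)
  then show ?thesis
    by (simp add: F_def)
qed

text \<open>Identified as the modulus of the Gregory coefficient of index \<open>k + 1\<close> in
  \<open>gregory_coeff_Suc\<close>.\<close>

definition gregory_weight :: "nat \<Rightarrow> real"
  where "gregory_weight k = integral {0<..<1} (\<lambda>x. binom_weight x k)"

lemma binom_weight_integrable: "(\<lambda>x. binom_weight x k) integrable_on {0<..<1}"
  using integrable_continuous_real[OF continuous_on_binom_weight] by (simp add: integrable_on_Icc_iff_Ioo)

lemma gregory_weight_pos: "gregory_weight k > 0"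
proof -
  have "integral {0..1} (\<lambda>x :: real. 0) < integral {0..1} (\<lambda>x. binom_weight x k)"
    by (rule integral_less_real) (auto intro: continuous_on_binom_weight binom_weight_pos)
  then show ?thesis
    by (simp add: gregory_weight_def integral_open_interval_real)
qed

text \<open>Sum and integral are exchanged by dominated convergence: the binomial weights sum to 1
  for each \<open>x\<close>, so a bound \<open>K\<close> on the pole factors bounds all partial
  sums.\<close>

lemma pole_sum_gregory_weight_aux:
  assumes z: "z \<notin> of_nat ` {1..}"
  shows "(\<lambda>k. of_real (gregory_weight k) * (of_nat (Suc k) / (of_nat (Suc k) - z))) sums
    integral {0<..<1} (\<lambda>x. pole_sum (binom_weight x) z)"
proof -
  obtain K where K: "\<And>k. cmod (of_nat (Suc k) / (of_nat (Suc k) - z)) \<le> K"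
    using pole_factor_locally_bounded[OF z] by (metis centre_in_cball less_imp_le)
  have K0: "0 \<le> K"
    using K[of 0] norm_ge_zero order_trans by blast
  define f where "f n x = (\<Sum>k<n. complex_of_real (binom_weight x k) * (of_nat (Suc k) / (of_nat (Suc k) - z)))" for n x
  have f: "(f n has_integral (\<Sum>k<n. of_real (gregory_weight k) * (of_nat (Suc k) / (of_nat (Suc k) - z)))) {0<..<1}" for n
    unfolding f_def gregory_weight_def
    by (intro has_integral_sum has_integral_mult_left has_integral_of_real integrable_integral binom_weight_integrable) auto
  have "(\<lambda>n. integral {0<..<1} (f n)) \<longlonglongrightarrow> integral {0<..<1} (\<lambda>x. pole_sum (binom_weight x) z)"
  proof (rule dominated_convergence(2))
    show "f n integrable_on {0<..<1}" for n
      using f by blast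
    show "(\<lambda>_. K) integrable_on {0<..<1::real}"
      by (metis integrable_const_ivl integrable_on_Icc_iff_Ioo)
    fix x :: real
    assume "x \<in> {0<..<1}"
    then have x: "0 < x" "x < 1" by auto
    show "(\<lambda>n. f n x) \<longlonglongrightarrow> pole_sum (binom_weight x) z"
      using pole_sum_sums[OF _ _ z, of "binom_weight x"] binom_weight_sums_1[OF x] x binom_weight_nonneg[of x]
      by (auto simp: f_def sums_def[where s = "pole_sum (binom_weight x) z"] dest: sums_summable)
    show "norm (f n x) \<le> K" for n
    proof -
      have "norm (f n x) \<le> (\<Sum>k<n. binom_weight x k * K)"
        unfolding f_def
      proof (intro sum_norm_le)
        show "norm (complex_of_real (binom_weight x k) * (of_nat (Suc k) / (of_nat (Suc k) - z))) \<le> binom_weight x k * K" for k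
          unfolding norm_mult using binom_weight_nonneg[OF x, of k] by (intro mult_mono K) auto
      qed
      also have "\<dots> = (\<Sum>k<n. binom_weight x k) * K"
        by (simp add: sum_distrib_right)
      also have "(\<Sum>k<n. binom_weight x k) \<le> 1"
        using binom_weight_sums_1[OF x] sum_le_suminf[of "binom_weight x" "{..<n}"] binom_weight_nonneg[of x] x by (simp add: sums_iff)
      finally show ?thesis
        using K0 by (simp add: mult_right_mono)
    qed
  qed
  moreover have "integral {0<..<1} (f n) = (\<Sum>k<n. of_real (gregory_weight k) * (of_nat (Suc k) / (of_nat (Suc k) - z)))" for n
    using f by (rule integral_unique)
  ultimately show ?thesis
    by (simp only: sums_def)
qed

text \<open>The point \<open>z = 0\<close>, where all pole factors equal 1.\<close>

lemma gregory_weight_sums_1: "gregory_weight sums 1"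
proof -
  have "pole_sum (binom_weight x) 0 = 1" if "x \<in> {0<..<1}" for x
    using that sums_of_real[OF binom_weight_sums_1[of x], where 'a = complex]
    by (simp add: pole_sum_def sums_iff del: of_nat_Suc)
  then have "integral {0<..<1} (\<lambda>x. pole_sum (binom_weight x) 0) = integral {0<..<1::real} (\<lambda>_. 1)"
    by (intro integral_cong) auto
  also have "\<dots> = 1"
    using has_integral_const_real[of "1::complex" 0 1] by (simp add: has_integral_Icc_iff_Ioo integral_unique)
  finally have "(\<lambda>k. complex_of_real (gregory_weight k)) sums of_real 1"
    using pole_sum_gregory_weight_aux[of 0] by (force simp del: of_nat_Suc)
  then show ?thesis
    by (simp only: sums_of_real_iff)
qed

lemma pole_sum_gregory_weight:
  assumes z: "z \<notin> of_nat ` {1..}"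
  shows "pole_sum gregory_weight z = Gamma (1 - z) *
    integral {0..1} (\<lambda>x. Gamma (of_real x + 1) * rGamma (of_real x - z + 1))"
proof -
  have "pole_sum gregory_weight z = integral {0<..<1} (\<lambda>x. pole_sum (binom_weight x) z)"
    unfolding pole_sum_def[of gregory_weight] using sums_unique[OF pole_sum_gregory_weight_aux[OF z]] by simp
  also have "\<dots> = integral {0<..<1} (\<lambda>x. Gamma (1 - z) * (Gamma (of_real x + 1) * rGamma (of_real x - z + 1)))"
    by (intro integral_cong pole_sum_binom_weight z) auto
  also have "\<dots> = Gamma (1 - z) * integral {0<..<1} (\<lambda>x. Gamma (of_real x + 1) * rGamma (of_real x - z + 1))"
    by simp
  \<comment> \<open>The endpoints, left out because the expansion was derived for
    \<open>0 < x < 1\<close>, do not affect the integral.\<close>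
  finally show ?thesis
    by (simp add: integral_open_interval_real)
qed

text \<open>Euler's reflection formula, in the form that matches the prefactor of the completed
  transform with the factor \<open>Gamma (1 - z)\<close> of
  \<open>pole_sum_gregory_weight\<close>.\<close>

lemma Gamma_reflection_sin:
  fixes z :: complex
  assumes "z \<notin> \<int>"
  shows "of_real pi * z / sin (of_real pi * z) * rGamma (z + 1) = Gamma (1 - z)"
proof -
  have z: "z \<noteq> 0" "z \<notin> \<int>\<^sub>\<le>\<^sub>0"
    using assms by auto
  then have "Gamma z \<noteq> 0"
    by (simp add: Gamma_eq_zero_iff)
  have "z * rGamma (z + 1) = rGamma z"
    by (rule rGamma_plus1)
  then have "of_real pi * z / sin (of_real pi * z) * rGamma (z + 1) = of_real pi / sin (of_real pi * z) * rGamma z"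
    by (metis mult.assoc times_divide_eq_left)
  also have "\<dots> = Gamma z * Gamma (1 - z) * rGamma z"
    by (simp only: Gamma_reflection_complex)
  also have "\<dots> = Gamma (1 - z)"
    using \<open>Gamma z \<noteq> 0\<close> by (simp add: rGamma_inverse_Gamma)
  finally show ?thesis .
qed

text \<open>At integers \<open>z \<le> 0\<close> the transform is a limit value, so the defining
  formula is compared with the pole sum only at nearby nonintegers, and continuity of the pole sum
  gives the limit.\<close>

lemma gregory_transform_pole_sum:
  assumes z: "z \<notin> of_nat ` {1..}"
  shows "gregory_transform z = pole_sum gregory_weight z"
  unfolding gregory_transform_def
proof (rule remove_sings_eqI)
  have gregory_weight: "\<And>k. gregory_weight k \<ge> 0" "summable gregory_weight"
    using gregory_weight_pos gregory_weight_sums_1 by (auto intro: less_imp_le sums_summable)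
  have op: "open (- of_nat ` {1..} :: complex set)"
    using closed_of_nat_image by blast
  have "isCont (pole_sum gregory_weight) z"
    using holomorphic_on_imp_continuous_on[OF pole_sum_holomorphic[OF gregory_weight]] op z
    by (simp add: continuous_on_eq_continuous_at)
  then have "pole_sum gregory_weight \<midarrow>z\<rightarrow> pole_sum gregory_weight z"
    by (simp add: isCont_def)
  moreover have "\<forall>\<^sub>F w in at z. of_real pi * w / sin (of_real pi * w) * gregory_fun w = pole_sum gregory_weight w"
  proof -
    \<comment> \<open>Taking \<open>z\<close> out of the integers covers integral and nonintegral
      \<open>z\<close> alike.\<close>
    have "open (- (\<int> - {z}))"
      using closed_subset_Ints by blast
    then have "\<forall>\<^sub>F w in at z. w \<in> - (\<int> - {z}) - {z}"
      by (intro eventually_at_in_open) auto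
    then have "\<forall>\<^sub>F w in at z. w \<notin> \<int>"
      by eventually_elim auto
    then show ?thesis
    proof eventually_elim
      case (elim w)
      then have "w \<notin> of_nat ` {1..}"
        by auto
      then show ?case
        using Gamma_reflection_sin[OF elim] by (simp only: gregory_fun_def pole_sum_gregory_weight not_False_eq_True flip: mult.assoc)
    qed
  qed
  ultimately show "(\<lambda>z. of_real pi * z / sin (of_real pi * z) * gregory_fun z) \<midarrow>z\<rightarrow> pole_sum gregory_weight z"
    by (simp add: tendsto_cong)
qed

text \<open>Integration over the exponent produces the generating function of the Gregory
  coefficients.\<close>

lemma has_integral_powr_exponent:
  fixes y :: real
  assumes "0 < y" "y < 1"
  shows "((\<lambda>x. (1 + y) powr x) has_integral y / ln (1 + y)) {0..1}"
proof -
  have "((\<lambda>x. (1 + y) powr x / ln (1 + y)) has_real_derivative (1 + y) powr t) (at t within {0..1})" for t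
  proof -
    have "((\<lambda>x. exp (x * ln (1 + y)) / ln (1 + y)) has_real_derivative exp (t * ln (1 + y))) (at t within {0..1})"
      using assms by (auto intro!: derivative_eq_intros)
    then show ?thesis
      using assms by (simp add: powr_def)
  qed
  then have "((\<lambda>x. (1 + y) powr x) has_integral
      (1 + y) powr 1 / ln (1 + y) - (1 + y) powr 0 / ln (1 + y)) {0..1}"
    by (intro fundamental_theorem_of_calculus[where f = "\<lambda>x. (1 + y) powr x / ln (1 + y)"])
      (simp_all add: has_real_derivative_iff_has_vector_derivative)
  then show ?thesis
    using assms by (simp flip: diff_divide_distrib)
qed

text \<open>A series with a nonzero coefficient has isolated zeros, whereas these zeros accumulate
  at 0 along the positive reals.\<close>

lemma powser_zero_imp_coeff_zero:
  fixes d :: "nat \<Rightarrow> complex"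
  assumes d: "\<And>y :: real. 0 < y \<Longrightarrow> y < 1 \<Longrightarrow> (\<lambda>n. d n * of_real y ^ n) sums 0"
  shows "d n = 0"
proof (rule ccontr)
  assume "d n \<noteq> 0"
  \<comment> \<open>The shift makes the value at \<open>0\<close> vanish, as \<open>powser_0_nonzero\<close> requires.\<close>
  define e where "e m = (case m of 0 \<Rightarrow> 0 | Suc m \<Rightarrow> d m)" for m
  define f where "f w = (\<Sum>m. e m * w ^ m)" for w
  have e: "(\<lambda>m. e m * of_real y ^ m) sums 0" if "0 < y" "y < 1" for y :: real
  proof -
    have "(\<lambda>m. of_real y * (d m * of_real y ^ m)) sums (of_real y * 0)"
      by (intro sums_mult d that)
    then have "(\<lambda>m. e (Suc m) * of_real y ^ Suc m) sums 0"
      by (simp add: e_def mult_ac)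
    then show ?thesis
      by (subst (asm) sums_Suc_iff) (simp add: e_def)
  qed
  have "summable (\<lambda>m. e m * of_real (1 / 2) ^ m)"
    by (rule sums_summable[OF e]) auto
  then have sums: "(\<lambda>m. e m * (w - 0) ^ m) sums f w" if "norm (w - 0) < 1 / 2" for w
    unfolding f_def using that powser_inside[of e "of_real (1 / 2)" w]
    by (simp add: summable_sums)
  have f0: "f 0 = 0"
    by (simp add: f_def e_def)
  have en: "e (Suc n) \<noteq> 0"
    using \<open>d n \<noteq> 0\<close> by (simp add: e_def)
  obtain s where s: "0 < s" "\<And>w. w \<in> cball 0 s - {0} \<Longrightarrow> f w \<noteq> 0"
    by (rule powser_0_nonzero[where r = "1 / 2", OF _ sums f0 en]) simp_all
  define y where "y = min s (1 / 2)"
  have "f (of_real y) = 0"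
    using e[of y] s(1) by (simp add: f_def y_def sums_iff)
  moreover have "of_real y \<in> cball 0 s - {0 :: complex}"
    using s(1) by (auto simp: y_def)
  ultimately show False
    using s(2) by blast
qed

text \<open>Newton's series \<open>(1 + y) powr x = (\<Sum>n. (x gchoose n) * y ^ n)\<close>,
  integrated over \<open>x\<close>, is compared coefficientwise with the generating function. This
  also fixes the alternating signs.\<close>

lemma gregory_coeff_Suc: "gregory_coeff (Suc k) = of_real ((-1) ^ k * gregory_weight k)"
proof -
  define c where "c n = (case n of 0 \<Rightarrow> 1 | Suc k \<Rightarrow> (-1) ^ k * gregory_weight k)" for n
  have int: "((\<lambda>x. x gchoose n) has_integral c n) {0<..<1::real}" for n
  proof (cases n)
    case 0
    then show ?thesis
      using has_integral_const_real[of "1::real" 0 1] by (simp add: c_def has_integral_Icc_iff_Ioo)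
  next
    case (Suc k)
    then show ?thesis
      unfolding Suc binom_weight_gbinomial using binom_weight_integrable
      by (auto simp: c_def gregory_weight_def intro!: has_integral_mult_right integrable_integral)
  qed
  \<comment> \<open>Makes the geometric series in \<open>y\<close> a dominating bound, uniform in
    \<open>x\<close>.\<close>
  have gb_le: "\<bar>x gchoose n\<bar> \<le> 1" if "0 < x" "x < 1" for x :: real and n
  proof (cases n)
    case (Suc k)
    have "binom_weight x k \<le> 1"
      using binom_weight_sums_1[OF that] sum_le_suminf[of "binom_weight x" "{k}"] binom_weight_nonneg[of x] that by (simp add: sums_iff)
    then show ?thesis
      using binom_weight_nonneg[of x k] that by (simp add: Suc binom_weight_gbinomial abs_mult)
  qed simp
  have sums: "(\<lambda>n. c n * y ^ n) sums (y / ln (1 + y))" if y: "0 < y" "y < 1" for y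
  proof -
    define f where "f m x = (\<Sum>n<m. (x gchoose n) * y ^ n)" for m and x :: real
    have f: "(f m has_integral (\<Sum>n<m. c n * y ^ n)) {0<..<1}" for m
      unfolding f_def by (intro has_integral_sum has_integral_mult_left int) auto
    have "(\<lambda>m. integral {0<..<1} (f m)) \<longlonglongrightarrow> integral {0<..<1} (\<lambda>x. (1 + y) powr x)"
    proof (rule dominated_convergence(2))
      show "f m integrable_on {0<..<1}" for m
        using f by blast
      show "(\<lambda>_. \<Sum>n. y ^ n) integrable_on {0<..<1::real}"
        by (metis integrable_const_ivl integrable_on_Icc_iff_Ioo)
      fix x :: real
      assume "x \<in> {0<..<1}"
      then have x: "0 < x" "x < 1" by auto
      show "(\<lambda>m. f m x) \<longlonglongrightarrow> (1 + y) powr x"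
        using gen_binomial_real[of y x] y by (simp add: f_def sums_def)
      show "norm (f m x) \<le> (\<Sum>n. y ^ n)" for m
      proof -
        have "norm (f m x) \<le> (\<Sum>n<m. y ^ n)"
          unfolding f_def using gb_le[OF x] y
          by (intro sum_norm_le) (auto simp: abs_mult intro!: mult_left_le_one_le)
        also have "\<dots> \<le> (\<Sum>n. y ^ n)"
          using y by (intro sum_le_suminf summable_geometric) auto
        finally show ?thesis .
      qed
    qed
    moreover have "integral {0<..<1} (f m) = (\<Sum>n<m. c n * y ^ n)" for m
      using f by (rule integral_unique)
    moreover have "integral {0<..<1} (\<lambda>x. (1 + y) powr x) = y / ln (1 + y)"
      using has_integral_powr_exponent[OF y] by (intro integral_unique) (simp add: has_integral_Icc_iff_Ioo)
    ultimately show ?thesis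
      by (simp add: sums_def)
  qed
  have "gregory_coeff n - of_real (c n) = 0" for n
  proof (rule powser_zero_imp_coeff_zero)
    fix y :: real
    assume y: "0 < y" "y < 1"
    have "Ln (1 + of_real y) = of_real (ln (1 + y))"
      using y Ln_of_real[of "1 + y"] by simp
    then have *: "(\<lambda>n. gregory_coeff n * of_real y ^ n) sums of_real (y / ln (1 + y))"
      using gregory_coeff_sums[of "of_real y"] y by simp
    have "(\<lambda>n. of_real (c n) * of_real y ^ n) sums (of_real (y / ln (1 + y)) :: complex)"
      using sums_of_real[OF sums[OF y], where 'a = complex] by simp
    from sums_diff[OF * this] show "(\<lambda>n. (gregory_coeff n - of_real (c n)) * of_real y ^ n) sums 0"
      by (simp add: left_diff_distrib)
  qed
  then show ?thesis
    by (simp add: c_def)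
qed

section \<open>The spectrum of the compressed operator\<close>

interpretation gregory: positive_weights gregory_weight
  by unfold_locales (use gregory_weight_pos gregory_weight_sums_1 sums_summable in auto)

text \<open>A vector \<open>v\<close> with the expected coordinates is built directly, and
  \<open>has_sum_ket\<close> identifies it with the unordered sum \<open>u_vec\<close>. Its norm is
  1 because the weights sum to 1.\<close>

lemma coord_u_vec: "n \<ge> 1 \<Longrightarrow> coord u_vec n = of_real (sqrt (cmod (gregory_coeff n)))"
  and norm_u_vec: "norm u_vec = 1"
proof -
  define c where "c n = (if n = 0 then 0 else complex_of_real (sqrt (cmod (gregory_coeff n))))" for n
  have "(\<lambda>k. (cmod (c (Suc k)))\<^sup>2) = gregory_weight"
    using gregory_weight_pos by (auto simp: c_def gregory_coeff_Suc norm_mult norm_power less_imp_le)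
  then have sums: "(\<lambda>n. (cmod (c n))\<^sup>2) sums 1"
    using gregory_weight_sums_1 sums_Suc[of "\<lambda>n. (cmod (c n))\<^sup>2" 1] by (simp add: c_def)
  define v where "v = Abs_ell2 c"
  have v: "coord v = c"
    unfolding v_def using sums by (intro Abs_ell2_inverse) (auto simp: c_def sums_iff)
  have "((\<lambda>n. complex_of_real (sqrt (cmod (gregory_coeff n))) *\<^sub>C ket n) has_sum v) {1..}"
    using has_sum_ket[of v] by (rule has_sum_cong[THEN iffD1, rotated]) (simp add: v c_def)
  then have u: "u_vec = v"
    by (simp add: u_vec_def infsumI)
  show "coord u_vec n = of_real (sqrt (cmod (gregory_coeff n)))" if "n \<ge> 1"
    using that by (simp add: u v c_def)
  show "norm u_vec = 1"
    using sums by (simp add: u norm_ell2_def v sums_iff)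
qed

interpretation u: unit_vector u_vec
  by unfold_locales (rule norm_u_vec)

lemma T_perp_compress: "T_perp = u.compress"
proof -
  have "P_op x = u.proj x" for x
    by (simp add: P_op_def Q_op_def orth_proj_span_unit[OF norm_u_vec] u.proj_def)
  then show ?thesis
    by (simp add: T_perp_def u.compress_def fun_eq_iff)
qed

lemma coord_u_vec_Suc: "coord u_vec (Suc k) = of_real (sqrt (gregory_weight k))"
  using gregory_weight_pos[of k] by (simp add: coord_u_vec gregory_coeff_Suc norm_mult norm_power)

lemma cinner_T_res_u_vec:
  assumes "z \<notin> of_nat ` {1..}"
  shows "cinner (T_res z u_vec) u_vec = pole_sum gregory_weight z"
proof -
  define f where "f n = coord (T_res z u_vec) n * cnj (coord u_vec n)" for n
  have "f (Suc k) = of_real (gregory_weight k) * (of_nat (Suc k) / (of_nat (Suc k) - z))" for k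
  proof -
    have "complex_of_real (sqrt (gregory_weight k)) * of_real (sqrt (gregory_weight k)) = of_real (gregory_weight k)"
      using gregory_weight_pos[of k] by (simp flip: of_real_mult)
    then show ?thesis
      unfolding f_def coord_T_res coord_u_vec_Suc complex_cnj_complex_of_real
      by (metis mult.assoc mult.commute)
  qed
  then have "(\<lambda>k. f (Suc k)) sums pole_sum gregory_weight z"
    using gregory.pole_sums[OF assms] by simp
  \<comment> \<open>The extra term \<open>f 0\<close> vanishes, as coordinate 0 is always 0.\<close>
  then have "f sums (pole_sum gregory_weight z + f 0)"
    by (rule sums_Suc)
  then show ?thesis
    by (simp add: cinner_def sums_iff f_def[abs_def] del: coord_T_res)
qed

lemma gregory_transform_real:
  assumes "n \<ge> 1" "real n < x" "x < real n + 1"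
  shows "gregory_transform (of_real x) = of_real (gregory.real_pole_sum x)"
  using gregory_transform_pole_sum gregory.real_pole_sum_sums(2) gregory.gap_notin[OF assms] by simp

text \<open>Inside a gap the transform agrees with the real pole sum, so the \<open>THE\<close> in
  \<open>gregory_zero\<close> denotes the unique zero found there.\<close>

lemma gregory_zero_eq_iff:
  assumes "n \<ge> 1"
  shows "real n < x \<and> x < real n + 1 \<and> gregory.real_pole_sum x = 0 \<longleftrightarrow> x = gregory_zero n"
proof -
  have "gregory_zero n = (THE x. real n < x \<and> x < real n + 1 \<and> gregory.real_pole_sum x = 0)"
    unfolding gregory_zero_def using gregory_transform_real[OF assms]
    by (intro arg_cong[where f = The] ext) auto
  then show ?thesis
    using theI'[OF gregory.real_pole_sum_zero_ex1[OF assms]] gregory.real_pole_sum_zero_ex1[OF assms] by metis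
qed

lemma pole_sum_gregory_zero_iff:
  "z \<notin> of_nat ` {1..} \<and> pole_sum gregory_weight z = 0 \<longleftrightarrow> (\<exists>n\<ge>1. z = of_real (gregory_zero n))"
  unfolding gregory.pole_sum_zero_iff using gregory_zero_eq_iff by metis

lemma T_perp_spectrum_iff:
  assumes "z \<noteq> 0"
  shows "1 / z \<in> spectrum T_perp \<longleftrightarrow> (\<exists>n\<ge>1. z = of_real (gregory_zero n))"
proof -
  have "coord u_vec n \<noteq> 0" if "n \<ge> 1" for n
    using that gregory_weight_pos[of "n - 1"] coord_u_vec_Suc[of "n - 1"] by simp
  then show ?thesis
    unfolding T_perp_compress using u.spectrum_compress[OF _ assms] cinner_T_res_u_vec pole_sum_gregory_zero_iff
    by metis
qed

theorem proposition6p1: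
  shows "(\<forall>z :: complex. z \<notin> of_nat ` {1..} \<longrightarrow>
            invertible_op (\<lambda>x. x - z *\<^sub>C T_op x) \<and>
            gregory_transform z = cinner (inv (\<lambda>x. x - z *\<^sub>C T_op x) u_vec) u_vec) \<and>
         spectrum T_perp - {0} = {complex_of_real (1 / gregory_zero n) | n. n \<ge> 1} \<and>
         (\<forall>\<mu>. \<mu> \<noteq> 0 \<and> is_eigenvalue T_perp \<mu> \<longrightarrow> is_simple_eigenvalue T_perp \<mu>)"
proof (intro conjI allI impI)
  fix z :: complex
  assume z: "z \<notin> of_nat ` {1..}"
  show "invertible_op (\<lambda>x. x - z *\<^sub>C T_op x)"
    by (rule invertible_op_T_op[OF z])
  show "gregory_transform z = cinner (inv (\<lambda>x. x - z *\<^sub>C T_op x) u_vec) u_vec"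
    using z by (simp add: invertible_op_T_op gregory_transform_pole_sum cinner_T_res_u_vec)
next
  \<comment> \<open>Guards the passage between \<open>\<mu>\<close> and its reciprocal.\<close>
  have zero_pos: "gregory_zero n > 0" if "n \<ge> 1" for n
    using gregory_zero_eq_iff[OF that, of "gregory_zero n"] that by auto
  show "spectrum T_perp - {0} = {complex_of_real (1 / gregory_zero n) | n. n \<ge> 1}"
  proof (intro equalityI subsetI)
    fix \<mu>
    assume "\<mu> \<in> spectrum T_perp - {0}"
    then obtain n where "n \<ge> 1" "1 / \<mu> = of_real (gregory_zero n)"
      using T_perp_spectrum_iff[of "1 / \<mu>"] by auto
    moreover from this have "\<mu> = of_real (1 / gregory_zero n)"
      by (metis div_by_1 divide_divide_eq_right mult_1 of_real_1 of_real_divide)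
    ultimately show "\<mu> \<in> {complex_of_real (1 / gregory_zero n) | n. n \<ge> 1}"
      by blast
  next
    fix \<mu>
    assume "\<mu> \<in> {complex_of_real (1 / gregory_zero n) | n. n \<ge> 1}"
    then obtain n where n: "n \<ge> 1" "\<mu> = 1 / of_real (gregory_zero n)"
      by auto
    then show "\<mu> \<in> spectrum T_perp - {0}"
      using T_perp_spectrum_iff[of "of_real (gregory_zero n)"] zero_pos[OF n(1)] by auto
  qed
next
  fix \<mu>
  assume \<mu>: "\<mu> \<noteq> 0 \<and> is_eigenvalue T_perp \<mu>"
  \<comment> \<open>An eigenvalue lies in the spectrum, so its reciprocal \<open>z\<close> is one of
    the zeros; in particular it is real, as simplicity requires.\<close>
  define z where "z = 1 / \<mu>"
  have z: "z \<noteq> 0" "\<mu> = 1 / z"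
    using \<mu> by (auto simp: z_def)
  have "1 / z \<in> spectrum T_perp"
    using \<mu> u.eigenvalue_in_spectrum z(2) by (simp add: T_perp_compress)
  then have ex: "\<exists>n\<ge>1. z = of_real (gregory_zero n)"
    using T_perp_spectrum_iff[OF z(1)] by simp
  then have "z \<notin> of_nat ` {1..}" "pole_sum gregory_weight z = 0" "z \<in> \<real>"
    using pole_sum_gregory_zero_iff by auto
  then show "is_simple_eigenvalue T_perp \<mu>"
    unfolding T_perp_compress z(2) using z(1) by (intro u.compress_simple_eigenvalue) (simp_all add: cinner_T_res_u_vec)
qed

end
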